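(* In each of the two cases (S) and (M) described in the context: given $\gamma\in(0,1)$, $\epsilon$ and $x\in\mathcal X$, for all $c\ge c^*_{\gamma,\epsilon}(x)$, $$\min_{\pi\in\Pi}\Bigl\{\max_{\alpha\in\mathcal A}J_{c,\gamma,\epsilon}(x',\alpha,\pi)\Bigr\}=\max_{\alpha\in\mathcal A}\Bigl\{\min_{\pi\in\Pi}J_{c,\gamma,\epsilon}(x',\alpha,\pi)\Bigr\},$$ where $x'=(x,0)$ in case (S) and $x'=(x,s)$ in case (M).
   Context: $\mathcal M$ is a discrete-time Markov decision process with finite state set $\mathcal X=\{0,1,\dots,N_X\}$, finite action set $\mathcal C=\{1,\dots,N_C\}$ and countable disturbance set $\mathcal W$. When action $u_t$ is taken in state $x_t$, disturbance $w_t\in\mathcal W$ occurs with probability $p(w_t|x_t,u_t)$, the next state is $x_{t+1}=f(x_t,u_t,w_t)$, and a one-stage cost $g(x_t,u_t,w_t)\ge 0$ is incurred; for each fixed $(x,u)$ the mean and variance of $g(x,u,w)$ under $p(\cdot|x,u)$ are finite. State $0$ is terminal: $f(0,u,w)=0$ and $g(0,u,w)=0$ for all $u,w$. Let $r_t=\sum_{k<t}g(x_k,u_k,w_k)$. Policies are randomized and history dependent: $u_t$ is chosen with a probability depending on $H_t=(x_0,r_0,u_0,\dots,x_t,r_t)$. Let $h_d(0)=0$ and $h_d(y)=1$ for $y\ne0$. Case (S) ($\epsilon\in(0,1)$, $\eta(\epsilon;c)=c(1-\epsilon)$, $x'=(x,0)$): $\Pi$ is the set of all policies of $\mathcal M$,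 $J_{obj}(x';\pi)=E^{\mathcal M,\pi}\{\mathbf 1[\exists t:\ x_t=0]\sum_{t\ge0}g(x_t,u_t,w_t)\mid x_0=x\}$ and $J_{cond}(x';\pi)=E^{\mathcal M,\pi}\{\sum_{t\ge0}\gamma^t(1-\gamma)h_d(x_t)\mid x_0=x\}$. Case (M) ($\epsilon>0$, $\eta(\epsilon;c)=c$, $x'=(x,s)$): consider the augmented MDP $\mathcal M_o^{(M)}$ with states $(x,i)\in\mathcal X\times\{s,f\}$ and actions $(u,j)\in\mathcal C\times\{s,f\}$; from $(x,i)$ under $(u,j)$ disturbance $w$ occurs with probability $p(w|x,u)$ and the next state is $(f(x,u,w),\theta(i,j))$ with $\theta(i,j)=s$ if $i=j=s$ and $\theta(i,j)=f$ otherwise; the one-stage cost is $G((x,s),(u,j),w)=g(x,u,w)$, $G((0,f),\cdot,\cdot)=1$, and $0$ otherwise. $\Pi$ is the set of all randomized history-dependent policies (depending on past augmented states, actions and accumulated costs) for this MDP; with $x'_t=(x_t,i_t)$ and actions $u'_t$, $J_{obj}(x';\pi)=E\{\sum_{t\ge0}G(x'_t,u'_t,w_t)\mid x'_0=x'\}$ and $J_{cond}(x';\pi)=E\{\sum_{t\ge0}\gamma^t(1-\gamma)h_d(x_t)\mid x'_0=x'\}$. In both cases $\mathcal A$ is the set of pairs $\alpha=(\alpha_o,\alpha_d)$, $\alpha_o,\alpha_d\ge0$, $\alpha_o+\alpha_d=1$, $$J_{c,\gamma,\epsilon}(x',\alpha,\pi)=\alpha_o J_{obj}(x';\pi)+\frac{\eta(\epsilon;c)}{\epsilon}\,\alpha_d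 J_{cond}(x';\pi)\quad(0\cdot\infty=0),$$ $$c^*_{\gamma,\epsilon}(x)=\min\Bigl\{c\in[0,\infty)\Bigm|\min_{\pi\in\Pi}\max_{\alpha\in\mathcal A}J_{c,\gamma,\epsilon}(x',\alpha,\pi)\le\eta(\epsilon;c)\Bigr\}.$$ *)

theory Defs
  imports "HOL-Probability.Probability"
begin

record ('s, 'a, 'w) mdp =
  actions :: "'a set"
  disturbance :: "'s \<Rightarrow> 'a \<Rightarrow> 'w pmf"
  trans :: "'s \<Rightarrow> 'a \<Rightarrow> 'w \<Rightarrow> 's"
  stage_cost :: "'s \<Rightarrow> 'a \<Rightarrow> 'w \<Rightarrow> real"

text \<open>A sample path is the sequence of pairs \<open>(u\<^sub>t, w\<^sub>t)\<close>; together with the initial state it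
  determines the states and the costs.\<close>

primrec state_at :: "('s, 'a, 'w) mdp \<Rightarrow> 's \<Rightarrow> (nat \<Rightarrow> 'a \<times> 'w) \<Rightarrow> nat \<Rightarrow> 's" where
  "state_at M x0 \<omega> 0 = x0"
| "state_at M x0 \<omega> (Suc t) = trans M (state_at M x0 \<omega> t) (fst (\<omega> t)) (snd (\<omega> t))"

definition cost_at :: "('s, 'a, 'w) mdp \<Rightarrow> 's \<Rightarrow> (nat \<Rightarrow> 'a \<times> 'w) \<Rightarrow> nat \<Rightarrow> real" where
  "cost_at M x0 \<omega> t = stage_cost M (state_at M x0 \<omega> t) (fst (\<omega> t)) (snd (\<omega> t))"

definition acc_cost :: "('s, 'a, 'w) mdp \<Rightarrow> 's \<Rightarrow> (nat \<Rightarrow> 'a \<times> 'w) \<Rightarrow> nat \<Rightarrow> real" where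
  "acc_cost M x0 \<omega> t = (\<Sum>k<t. cost_at M x0 \<omega> k)"

text \<open>The history \<open>H\<^sub>t = (x\<^sub>0, r\<^sub>0, u\<^sub>0, \<dots>, x\<^sub>t, r\<^sub>t)\<close> is split into the list of the triples
  \<open>(x\<^sub>k, r\<^sub>k, u\<^sub>k)\<close>, \<open>k < t\<close>, and the final pair \<open>(x\<^sub>t, r\<^sub>t)\<close>. Disturbances are not observed.\<close>

type_synonym ('s, 'a) history = "('s \<times> real \<times> 'a) list \<times> ('s \<times> real)"

definition hist_at :: "('s, 'a, 'w) mdp \<Rightarrow> 's \<Rightarrow> (nat \<Rightarrow> 'a \<times> 'w) \<Rightarrow> nat \<Rightarrow> ('s, 'a) history" where
  "hist_at M x0 \<omega> t =
     (map (\<lambda>k. (state_at M x0 \<omega> k, acc_cost M x0 \<omega> k, fst (\<omega> k))) [0..<t],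
      (state_at M x0 \<omega> t, acc_cost M x0 \<omega> t))"

type_synonym ('s, 'a) policy = "('s, 'a) history \<Rightarrow> 'a pmf"

definition policies :: "('s, 'a, 'w) mdp \<Rightarrow> ('s, 'a) policy set" where
  "policies M = {\<pi>. \<forall>H. set_pmf (\<pi> H) \<subseteq> actions M}"

definition step_kernel ::
  "('s, 'a, 'w) mdp \<Rightarrow> ('s, 'a) policy \<Rightarrow> 's \<Rightarrow> nat \<Rightarrow> (nat \<Rightarrow> 'a \<times> 'w) \<Rightarrow> ('a \<times> 'w) measure" where
  "step_kernel M \<pi> x0 t \<omega> = measure_pmf
     (bind_pmf (\<pi> (hist_at M x0 \<omega> t))
        (\<lambda>u. map_pmf (Pair u) (disturbance M (state_at M x0 \<omega> t) u)))"

text \<open>The law of the sample path started in \<open>x0\<close> is the Ionescu-Tulcea measure of these kernels.\<close>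

definition path_measure ::
  "('s, 'a, 'w) mdp \<Rightarrow> ('s, 'a) policy \<Rightarrow> 's \<Rightarrow> (nat \<Rightarrow> 'a \<times> 'w) measure" where
  "path_measure M \<pi> x0 =
     projective_family.lim UNIV
       (Ionescu_Tulcea.CI (step_kernel M \<pi> x0) (\<lambda>_. count_space UNIV)) (\<lambda>_. count_space UNIV)"

lemma Ionescu_Tulcea_step_kernel:
  fixes M :: "('s, 'a::countable, 'w::countable) mdp"
  shows "Ionescu_Tulcea (step_kernel M \<pi> x0) (\<lambda>_. count_space UNIV)"
proof (rule Ionescu_Tulcea.intro)
  fix i :: nat
  have eq: "PiM {0..<i} (\<lambda>_. count_space (UNIV :: ('a \<times> 'w) set)) =
      count_space (PiE {0..<i} (\<lambda>_. UNIV))"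
    by (intro count_space_PiM_finite finite_atLeastLessThan) auto
  show "step_kernel M \<pi> x0 i \<in>
      PiM {0..<i} (\<lambda>_. count_space UNIV) \<rightarrow>\<^sub>M subprob_algebra (count_space UNIV)"
    unfolding eq by (auto simp: step_kernel_def measure_pmf_in_subprob_algebra)
next
  fix i :: nat and \<omega> :: "nat \<Rightarrow> 'a \<times> 'w"
  show "prob_space (step_kernel M \<pi> x0 i \<omega>)"
    unfolding step_kernel_def by (rule measure_pmf.prob_space_axioms)
qed

lemma prob_space_path_measure:
  fixes M :: "('s, 'a::countable, 'w::countable) mdp"
  shows "prob_space (path_measure M \<pi> x0)"
proof -
  interpret Ionescu_Tulcea "step_kernel M \<pi> x0" "\<lambda>_. count_space UNIV"
    by (rule Ionescu_Tulcea_step_kernel)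
  have emb: "PF.emb UNIV {} (space (PiM {} (\<lambda>_. count_space UNIV))) = space PF.lim"
    by (auto simp: prod_emb_def space_PiM)
  have "emeasure PF.lim (space PF.lim) = emeasure (CI {}) (space (CI {}))"
    unfolding emb[symmetric] by (subst lim) (auto simp: CI_def)
  also have "\<dots> = 1"
    using PF.prob_space_P[of "{}"] by (intro prob_space.emeasure_space_1) auto
  finally show ?thesis
    unfolding path_measure_def by (rule prob_spaceI)
qed

definition h_d :: "nat \<Rightarrow> real" where
  "h_d y = (if y = 0 then 0 else 1)"

text \<open>\<open>\<xi>\<close> extracts the state of the original process, which is a component of the state in the
  augmented process.\<close>

definition J_cond ::
  "('s, 'a, 'w) mdp \<Rightarrow> ('s \<Rightarrow> nat) \<Rightarrow> real \<Rightarrow> 's \<Rightarrow> ('s, 'a) policy \<Rightarrow> ennreal" where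
  "J_cond M \<xi> \<gamma> x0 \<pi> =
     (\<integral>\<^sup>+\<omega>. (\<Sum>t. ennreal (\<gamma> ^ t * (1 - \<gamma>) * h_d (\<xi> (state_at M x0 \<omega> t)))) \<partial>path_measure M \<pi> x0)"

definition weights :: "(real \<times> real) set" where
  "weights = {(ao, ad). 0 \<le> ao \<and> 0 \<le> ad \<and> ao + ad = 1}"

text \<open>In \<open>ennreal\<close>, \<open>0 * \<infinity> = 0\<close>. The argument \<open>e\<close> is the value \<open>\<eta>(\<epsilon>; c)\<close>.\<close>

definition scalarize :: "real \<Rightarrow> real \<Rightarrow> ennreal \<Rightarrow> ennreal \<Rightarrow> real \<times> real \<Rightarrow> ennreal" where
  "scalarize e \<epsilon> jobj jcond \<alpha> = ennreal (fst \<alpha>) * jobj + ennreal (e / \<epsilon> * snd \<alpha>) * jcond"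

text \<open>\<open>c_star \<eta> P J\<close> is the least \<open>c \<ge> 0\<close> with
  \<open>min max J c \<le> \<eta> c\<close>, and \<open>\<infinity>\<close> if there is none. Minima are written as infima, which agree with
  them whenever they exist.\<close>

definition c_star ::
  "(real \<Rightarrow> real) \<Rightarrow> 'p set \<Rightarrow> (real \<Rightarrow> real \<times> real \<Rightarrow> 'p \<Rightarrow> ennreal) \<Rightarrow> ereal" where
  "c_star \<eta> P J =
     Inf (ereal ` {c. 0 \<le> c \<and> (INF \<pi>\<in>P. SUP \<alpha>\<in>weights. J c \<alpha> \<pi>) \<le> ennreal (\<eta> c)})"

text \<open>Equality of minimax and maximin; the membership conditions say that all four extrema are
  attained, i.e. that they are minima and maxima.\<close>

definition minimax_equality :: "'p set \<Rightarrow> 'q set \<Rightarrow> ('q \<Rightarrow> 'p \<Rightarrow> ennreal) \<Rightarrow> bool" where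
  "minimax_equality P A J \<longleftrightarrow>
     (INF \<pi>\<in>P. SUP \<alpha>\<in>A. J \<alpha> \<pi>) = (SUP \<alpha>\<in>A. INF \<pi>\<in>P. J \<alpha> \<pi>) \<and>
     (\<forall>\<pi>\<in>P. (SUP \<alpha>\<in>A. J \<alpha> \<pi>) \<in> (\<lambda>\<alpha>. J \<alpha> \<pi>) ` A) \<and>
     (INF \<pi>\<in>P. SUP \<alpha>\<in>A. J \<alpha> \<pi>) \<in> (\<lambda>\<pi>. SUP \<alpha>\<in>A. J \<alpha> \<pi>) ` P \<and>
     (\<forall>\<alpha>\<in>A. (INF \<pi>\<in>P. J \<alpha> \<pi>) \<in> (\<lambda>\<pi>. J \<alpha> \<pi>) ` P) \<and>
     (SUP \<alpha>\<in>A. INF \<pi>\<in>P. J \<alpha> \<pi>) \<in> (\<lambda>\<alpha>. INF \<pi>\<in>P. J \<alpha> \<pi>) ` A"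

definition base_mdp ::
  "nat \<Rightarrow> (nat \<Rightarrow> nat \<Rightarrow> 'w pmf) \<Rightarrow> (nat \<Rightarrow> nat \<Rightarrow> 'w \<Rightarrow> nat) \<Rightarrow> (nat \<Rightarrow> nat \<Rightarrow> 'w \<Rightarrow> real) \<Rightarrow>
   (nat, nat, 'w) mdp" where
  "base_mdp NC p f g = \<lparr>actions = {1..NC}, disturbance = p, trans = f, stage_cost = g\<rparr>"

definition eta_S :: "real \<Rightarrow> real \<Rightarrow> real" where
  "eta_S \<epsilon> c = c * (1 - \<epsilon>)"

definition J_obj_S :: "(nat, 'a, 'w) mdp \<Rightarrow> nat \<Rightarrow> (nat, 'a) policy \<Rightarrow> ennreal" where
  "J_obj_S M x0 \<pi> =
     (\<integral>\<^sup>+\<omega>. indicator {\<omega>. \<exists>t. state_at M x0 \<omega> t = 0} \<omega> * (\<Sum>t. ennreal (cost_at M x0 \<omega> t))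
        \<partial>path_measure M \<pi> x0)"

text \<open>The initial extended state \<open>(x, 0)\<close> consists of \<open>x\<^sub>0 = x\<close> and \<open>r\<^sub>0 = 0\<close>; the latter holds by
  definition of \<open>acc_cost\<close>, so only \<open>x\<close> is passed.\<close>

definition J_S ::
  "(nat, 'a, 'w) mdp \<Rightarrow> real \<Rightarrow> real \<Rightarrow> nat \<Rightarrow> real \<Rightarrow> real \<times> real \<Rightarrow> (nat, 'a) policy \<Rightarrow> ennreal" where
  "J_S M \<gamma> \<epsilon> x c \<alpha> \<pi> =
     scalarize (eta_S \<epsilon> c) \<epsilon> (J_obj_S M x \<pi>) (J_cond M id \<gamma> x \<pi>) \<alpha>"

datatype mark = Mark_s | Mark_f

instance mark :: countable
  by countable_datatype

definition theta :: "mark \<Rightarrow> mark \<Rightarrow> mark" where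
  "theta i j = (if i = Mark_s \<and> j = Mark_s then Mark_s else Mark_f)"

fun aug_cost :: "(nat \<Rightarrow> nat \<Rightarrow> 'w \<Rightarrow> real) \<Rightarrow> nat \<times> mark \<Rightarrow> nat \<times> mark \<Rightarrow> 'w \<Rightarrow> real" where
  "aug_cost g (x, Mark_s) (u, j) w = g x u w"
| "aug_cost g (x, Mark_f) (u, j) w = (if x = 0 then 1 else 0)"

definition aug_mdp ::
  "nat \<Rightarrow> (nat \<Rightarrow> nat \<Rightarrow> 'w pmf) \<Rightarrow> (nat \<Rightarrow> nat \<Rightarrow> 'w \<Rightarrow> nat) \<Rightarrow> (nat \<Rightarrow> nat \<Rightarrow> 'w \<Rightarrow> real) \<Rightarrow>
   (nat \<times> mark, nat \<times> mark, 'w) mdp" where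
  "aug_mdp NC p f g =
     \<lparr>actions = {1..NC} \<times> {Mark_s, Mark_f},
      disturbance = (\<lambda>(x, i) (u, j). p x u),
      trans = (\<lambda>(x, i) (u, j) w. (f x u w, theta i j)),
      stage_cost = aug_cost g\<rparr>"

definition eta_M :: "real \<Rightarrow> real \<Rightarrow> real" where
  "eta_M \<epsilon> c = c"

definition J_obj_M :: "('s, 'a, 'w) mdp \<Rightarrow> 's \<Rightarrow> ('s, 'a) policy \<Rightarrow> ennreal" where
  "J_obj_M M x0 \<pi> = (\<integral>\<^sup>+\<omega>. (\<Sum>t. ennreal (cost_at M x0 \<omega> t)) \<partial>path_measure M \<pi> x0)"

definition J_M ::
  "(nat \<times> mark, 'a, 'w) mdp \<Rightarrow> real \<Rightarrow> real \<Rightarrow> nat \<times> mark \<Rightarrow> real \<Rightarrow> real \<times> real \<Rightarrow>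
   (nat \<times> mark, 'a) policy \<Rightarrow> ennreal" where
  "J_M M \<gamma> \<epsilon> x' c \<alpha> \<pi> =
     scalarize (eta_M \<epsilon> c) \<epsilon> (J_obj_M M x' \<pi>) (J_cond M fst \<gamma> x' \<pi>) \<alpha>"

end

theory Submission
  imports Defs "HOL-Complex_Analysis.Great_Picard"
begin

text \<open>Both criteria are suprema over \<open>n\<close> of expectations of functionals of the first \<open>n\<close> steps. Such
  expectations are lower semicontinuous in the policy for pointwise convergence of the action
  probabilities, for which the policies form a sequentially compact set, and the set of attainable
  pairs (objective, condition) is convex up to domination. All minima are therefore attained, and a
  line separating the attainable pairs of finite objective from the open quadrant below the minimax
  value yields optimal weights. If these are \<open>(0, 1)\<close>, policies with infinite objective also have to
  be controlled: any value of the discounted condition is approximated by policies with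
  finite objective, which follow dynamic programming up to a time \<open>T\<close> and afterwards avoid the
  terminal state if they can; otherwise it is reached in geometrically bounded time.\<close>

section \<open>Laws of finite prefixes\<close>

text \<open>The objective may be infinite, and along a sequence of policies cost can escape to ever
  later times, so continuity in the policy is out of reach. Lower semicontinuity survives, since a
  supremum over horizons inherits it, and it is what minimization over policies asks for. The
  maximum over weights sits at an endpoint, so the minimax value minimizes the larger of two
  numbers, and a separation in the plane takes the place of a general minimax theorem. For a policy
  of infinite objective the weighted sum jumps at (0, 1): every other weight vector makes it
  infinite. The minimum at (0, 1) could therefore lie below everything the separating line sees.
  Discounting closes this gap, because decisions after time \<open>T\<close> change the condition by
  at most \<gamma>^T. They can thus be spent on keeping the objective finite.\<close>

definition prefix_step ::
  "('s, 'a, 'w) mdp \<Rightarrow> ('s, 'a) policy \<Rightarrow> 's \<Rightarrow> ('a \<times> 'w) list \<Rightarrow> ('a \<times> 'w) pmf" where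
  "prefix_step M \<pi> x0 a =
     bind_pmf (\<pi> (hist_at M x0 ((!) a) (length a)))
       (\<lambda>u. map_pmf (Pair u) (disturbance M (state_at M x0 ((!) a) (length a)) u))"

text \<open>Lists give the first \<open>n\<close> steps a discrete law. \<open>(!) a\<close> serves
  as a path: its values beyond the end of \<open>a\<close> are unspecified but never read, because
  \<open>state_at\<close> and \<open>hist_at\<close> at time \<open>length a\<close> look only at
  earlier coordinates.\<close>

primrec prefix_pmf ::
  "('s, 'a, 'w) mdp \<Rightarrow> ('s, 'a) policy \<Rightarrow> 's \<Rightarrow> nat \<Rightarrow> ('a \<times> 'w) list pmf" where
  "prefix_pmf M \<pi> x0 0 = return_pmf []"
| "prefix_pmf M \<pi> x0 (Suc n) =
     bind_pmf (prefix_pmf M \<pi> x0 n) (\<lambda>a. map_pmf (\<lambda>z. a @ [z]) (prefix_step M \<pi> x0 a))"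

lemma length_prefix_pmf: "a \<in> set_pmf (prefix_pmf M \<pi> x0 n) \<Longrightarrow> length a = n"
  by (induction n arbitrary: a) auto

lemma state_at_cong: "(\<And>k. k < t \<Longrightarrow> \<omega> k = \<omega>' k) \<Longrightarrow> state_at M x0 \<omega> t = state_at M x0 \<omega>' t"
  by (induction t) auto

lemma cost_at_cong: "(\<And>k. k \<le> t \<Longrightarrow> \<omega> k = \<omega>' k) \<Longrightarrow> cost_at M x0 \<omega> t = cost_at M x0 \<omega>' t"
  using state_at_cong[of t \<omega> \<omega>' M x0] by (simp add: cost_at_def)

lemma acc_cost_cong: "(\<And>k. k < t \<Longrightarrow> \<omega> k = \<omega>' k) \<Longrightarrow> acc_cost M x0 \<omega> t = acc_cost M x0 \<omega>' t"
  unfolding acc_cost_def by (intro sum.cong cost_at_cong) auto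

lemma hist_at_cong: 
  assumes "\<And>k. k < t \<Longrightarrow> \<omega> k = \<omega>' k"
  shows "hist_at M x0 \<omega> t = hist_at M x0 \<omega>' t"
proof -
  have "state_at M x0 \<omega> k = state_at M x0 \<omega>' k" "acc_cost M x0 \<omega> k = acc_cost M x0 \<omega>' k"
    if "k \<le> t" for k
    using that assms by (auto intro!: state_at_cong acc_cost_cong)
  then show ?thesis using assms by (auto simp: hist_at_def)
qed

lemma step_kernel_eq:
  "step_kernel M \<pi> x0 n \<omega> = measure_pmf (prefix_step M \<pi> x0 (map \<omega> [0..<n]))"
proof -
  have "hist_at M x0 ((!) (map \<omega> [0..<n])) n = hist_at M x0 \<omega> n"
       "state_at M x0 ((!) (map \<omega> [0..<n])) n = state_at M x0 \<omega> n"
    by (auto intro!: hist_at_cong state_at_cong)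
  then show ?thesis by (simp add: step_kernel_def prefix_step_def)
qed

lemma count_space_PiM_initial:
  "PiM {0..<n::nat} (\<lambda>_. count_space (UNIV :: 'b::countable set)) = count_space (PiE {0..<n} (\<lambda>_. UNIV))"
  by (intro count_space_PiM_finite finite_atLeastLessThan) auto

lemma sets_path_measure:
  fixes M :: "('s, 'a::countable, 'w::countable) mdp"
  shows "sets (path_measure M \<pi> x0) = sets (PiM UNIV (\<lambda>_. count_space UNIV))"
proof -
  interpret Ionescu_Tulcea "step_kernel M \<pi> x0" "\<lambda>_. count_space UNIV"
    by (rule Ionescu_Tulcea_step_kernel)
  show ?thesis by (simp add: path_measure_def)
qed

lemma measurable_prefix:
  fixes M :: "('s, 'a::countable, 'w::countable) mdp"
  shows "(\<lambda>\<omega>. \<phi> (map \<omega> [0..<n]) :: ennreal) \<in> borel_measurable (path_measure M \<pi> x0)"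
proof -
  have "(\<lambda>\<omega>. \<phi> (map \<omega> [0..<n])) \<in> borel_measurable (PiM {0..<n} (\<lambda>_. count_space (UNIV :: ('a \<times> 'w) set)))"
    unfolding count_space_PiM_initial by simp
  then have "(\<lambda>\<omega>. \<phi> (map (restrict \<omega> {0..<n}) [0..<n]))
      \<in> borel_measurable (PiM UNIV (\<lambda>_. count_space (UNIV :: ('a \<times> 'w) set)))"
    by (rule measurable_compose[rotated]) (auto intro!: measurable_restrict)
  moreover have "map (restrict \<omega> {0..<n}) [0..<n] = map \<omega> [0..<n]" for \<omega> :: "nat \<Rightarrow> 'a \<times> 'w"
    by auto
  ultimately show ?thesis
    by (simp add: measurable_cong_sets[OF sets_path_measure refl])
qed

text \<open>The marginals of the limit measure on initial segments come from the iterated kernels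
  \<open>C 0 n\<close>, and these obey the recursion of \<open>prefix_pmf\<close>. This is the
  bridge from product measures to pmfs on lists.\<close>

lemma nn_integral_path_measure_prefix:
  fixes M :: "('s, 'a::countable, 'w::countable) mdp"
  shows "(\<integral>\<^sup>+\<omega>. \<phi> (map \<omega> [0..<n]) \<partial>path_measure M \<pi> x0) = (\<integral>\<^sup>+a. \<phi> a \<partial>prefix_pmf M \<pi> x0 n)"
proof -
  interpret Ionescu_Tulcea "step_kernel M \<pi> x0" "\<lambda>_. count_space UNIV"
    by (rule Ionescu_Tulcea_step_kernel)
  let ?N = "\<lambda>n. PiM {0..<n::nat} (\<lambda>_. count_space (UNIV :: ('a \<times> 'w) set))"
  have meas: "h \<in> borel_measurable (?N n)" for h :: "(nat \<Rightarrow> 'a \<times> 'w) \<Rightarrow> ennreal" and n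
    unfolding count_space_PiM_initial by simp
  have und: "(\<lambda>x. undefined) \<in> space (?N 0)" by (simp add: space_PiM)
  have C: "(\<integral>\<^sup>+\<omega>. \<phi> (map \<omega> [0..<n]) \<partial>C 0 n (\<lambda>x. undefined)) = (\<integral>\<^sup>+a. \<phi> a \<partial>prefix_pmf M \<pi> x0 n)" for n \<phi>
  proof (induction n arbitrary: \<phi>)
    case 0
    then show ?case by (simp add: nn_integral_return meas[of _ 0, simplified] und[simplified])
  next
    case (Suc n)
    have eP': "eP n \<in> measurable (C 0 n (\<lambda>x. undefined)) (subprob_algebra (?N (Suc n)))"
      using measurable_eP[of n] sets_C[OF und, of n]
      by (simp add: measurable_cong_sets[OF sets_C[OF und, of n] refl])
    have "(\<integral>\<^sup>+\<omega>. \<phi> (map \<omega> [0..<Suc n]) \<partial>C 0 (Suc n) (\<lambda>x. undefined)) =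
        (\<integral>\<^sup>+\<omega>. \<integral>\<^sup>+\<omega>'. \<phi> (map \<omega>' [0..<Suc n]) \<partial>eP n \<omega> \<partial>C 0 n (\<lambda>x. undefined))"
      unfolding C.simps add_0 by (rule nn_integral_bind[OF meas eP'])
    also have "\<dots> = (\<integral>\<^sup>+\<omega>. (\<integral>\<^sup>+z. \<phi> (map \<omega> [0..<n] @ [z]) \<partial>prefix_step M \<pi> x0 (map \<omega> [0..<n])) \<partial>C 0 n (\<lambda>x. undefined))"
    proof (rule nn_integral_cong)
      fix \<omega> assume "\<omega> \<in> space (C 0 n (\<lambda>x. undefined))"
      then have w: "\<omega> \<in> space (?N n)" using space_C[OF und, of n] by simp
      have eq: "map (fun_upd \<omega> n z) [0..<Suc n] = map \<omega> [0..<n] @ [z]" for z by simp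
      show "(\<integral>\<^sup>+\<omega>'. \<phi> (map \<omega>' [0..<Suc n]) \<partial>eP n \<omega>) =
          (\<integral>\<^sup>+z. \<phi> (map \<omega> [0..<n] @ [z]) \<partial>prefix_step M \<pi> x0 (map \<omega> [0..<n]))"
        unfolding nn_integral_eP[OF w meas] eq step_kernel_eq ..
    qed
    also have "\<dots> = (\<integral>\<^sup>+a. \<phi> a \<partial>prefix_pmf M \<pi> x0 (Suc n))"
      by (subst Suc.IH[of "\<lambda>a. \<integral>\<^sup>+z. \<phi> (a @ [z]) \<partial>prefix_step M \<pi> x0 a"]) simp
    finally show ?case .
  qed
  \<comment> \<open>\<open>CI\<close> runs the kernels up to the least bound \<open>up_to\<close> of
    the index set and then restricts; for an initial segment that bound is its length.\<close>
  have up: "up_to {0..<n} = n"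
  proof (rule antisym)
    show "up_to {0..<n} \<le> n" by (simp add: up_to_iff)
    show "n \<le> up_to {0..<n}" using up_to_iff[of "{0..<n}" "up_to {0..<n}"] by (cases n) auto
  qed
  have r: "map (restrict \<omega> {0..<n}) [0..<n] = map \<omega> [0..<n]" for \<omega> :: "nat \<Rightarrow> 'a \<times> 'w"
    by auto
  have res: "(\<lambda>\<omega>. restrict \<omega> {0..<n}) \<in> measurable (C 0 n (\<lambda>x. undefined)) (?N n)"
    by (subst measurable_cong_sets[OF sets_C[OF und, of n] refl]) (auto intro!: measurable_restrict)
  have res': "(\<lambda>\<omega>. restrict \<omega> {0..<n}) \<in> measurable PF.lim (?N n)"
    by (subst measurable_cong_sets[OF PF.sets_lim refl]) (auto intro!: measurable_restrict)
  have "(\<integral>\<^sup>+\<omega>. \<phi> (map \<omega> [0..<n]) \<partial>PF.lim) =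
      (\<integral>\<^sup>+\<omega>. \<phi> (map \<omega> [0..<n]) \<partial>distr PF.lim (?N n) (\<lambda>\<omega>. restrict \<omega> {0..<n}))"
    by (subst nn_integral_distr[OF res']) (simp_all add: meas r del: map_eq_conv)
  also have "\<dots> = (\<integral>\<^sup>+\<omega>. \<phi> (map \<omega> [0..<n]) \<partial>CI {0..<n})"
    by (subst distr_lim) auto
  also have "\<dots> = (\<integral>\<^sup>+\<omega>. \<phi> (map \<omega> [0..<n]) \<partial>C 0 n (\<lambda>x. undefined))"
    unfolding CI_def up by (subst nn_integral_distr[OF res]) (simp_all add: meas r del: map_eq_conv)
  finally show ?thesis using C by (simp add: path_measure_def)
qed

section \<open>The criteria as suprema over finite horizons\<close>

definition adapted :: "(nat \<Rightarrow> (nat \<Rightarrow> 'z) \<Rightarrow> ennreal) \<Rightarrow> bool" where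
  "adapted G \<longleftrightarrow> (\<forall>n \<omega> \<omega>'. (\<forall>k<n. \<omega> k = \<omega>' k) \<longrightarrow> G n \<omega> = G n \<omega>')"

text \<open>In this form lower semicontinuity and convexity can be checked for each horizon
  separately, as both pass to suprema.\<close>

definition prefix_value ::
  "('s, 'a, 'w) mdp \<Rightarrow> 's \<Rightarrow> (nat \<Rightarrow> (nat \<Rightarrow> 'a \<times> 'w) \<Rightarrow> ennreal) \<Rightarrow> ('s, 'a) policy \<Rightarrow> ennreal" where
  "prefix_value M x0 G \<pi> = (SUP n. \<integral>\<^sup>+a. G n ((!) a) \<partial>prefix_pmf M \<pi> x0 n)"

lemma nn_integral_path_SUP:
  fixes M :: "('s, 'a::countable, 'w::countable) mdp"
  assumes "adapted G" and mono: "\<And>\<omega>. incseq (\<lambda>n. G n \<omega>)"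
  shows "(\<integral>\<^sup>+\<omega>. (SUP n. G n \<omega>) \<partial>path_measure M \<pi> x0) = prefix_value M x0 G \<pi>"
proof -
  have G: "G n \<omega> = G n ((!) (map \<omega> [0..<n]))" for n \<omega>
    using assms(1) by (auto simp: adapted_def)
  have "(\<integral>\<^sup>+\<omega>. (SUP n. G n \<omega>) \<partial>path_measure M \<pi> x0) = (SUP n. \<integral>\<^sup>+\<omega>. G n \<omega> \<partial>path_measure M \<pi> x0)"
  proof (rule nn_integral_monotone_convergence_SUP)
    show "incseq G" using mono by (auto simp: incseq_def le_fun_def)
    show "G n \<in> borel_measurable (path_measure M \<pi> x0)" for n
      using measurable_prefix[of "\<lambda>a. G n ((!) a)" n M \<pi> x0] G[of n] by (simp cong: measurable_cong)
  qed
  also have "\<dots> = prefix_value M x0 G \<pi>"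
    unfolding prefix_value_def
    by (simp only: nn_integral_path_measure_prefix[symmetric] G[symmetric])
  finally show ?thesis .
qed

definition cost_sum :: "('s, 'a, 'w) mdp \<Rightarrow> 's \<Rightarrow> nat \<Rightarrow> (nat \<Rightarrow> 'a \<times> 'w) \<Rightarrow> ennreal" where
  "cost_sum M x0 n \<omega> = (\<Sum>t<n. ennreal (cost_at M x0 \<omega> t))"

text \<open>Whether a path ever reaches 0 is not decided at a fixed time. Crediting the cost only
  once 0 has been seen gives adapted, increasing functionals whose supremum is the integrand of
  \<open>J_obj_S\<close>. The bound \<open>t \<le> n\<close> is the right one because
  \<open>n\<close> steps determine the state at time \<open>n\<close>.\<close>

definition stopped_cost_sum :: "(nat, 'a, 'w) mdp \<Rightarrow> nat \<Rightarrow> nat \<Rightarrow> (nat \<Rightarrow> 'a \<times> 'w) \<Rightarrow> ennreal" where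
  "stopped_cost_sum M x0 n \<omega> = (if \<exists>t\<le>n. state_at M x0 \<omega> t = 0 then cost_sum M x0 n \<omega> else 0)"

definition disc_sum ::
  "('s, 'a, 'w) mdp \<Rightarrow> ('s \<Rightarrow> nat) \<Rightarrow> real \<Rightarrow> 's \<Rightarrow> nat \<Rightarrow> (nat \<Rightarrow> 'a \<times> 'w) \<Rightarrow> ennreal" where
  "disc_sum M \<xi> \<gamma> x0 n \<omega> = (\<Sum>t<n. ennreal (\<gamma> ^ t * (1 - \<gamma>) * h_d (\<xi> (state_at M x0 \<omega> t))))"

lemma incseq_sum_ennreal: "incseq (\<lambda>n. \<Sum>t<n. f t :: ennreal)"
  by (auto simp: incseq_def intro!: sum_mono2)

lemma adapted_cost_sum: "adapted (cost_sum M x0)"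
  unfolding adapted_def cost_sum_def
  by (auto intro!: sum.cong arg_cong[where f=ennreal] cost_at_cong)

lemma adapted_stopped_cost_sum:
  fixes M :: "(nat, 'a, 'w) mdp"
  shows "adapted (stopped_cost_sum M x0)"
  unfolding adapted_def
proof safe
  fix n and \<omega> \<omega>' :: "nat \<Rightarrow> 'a \<times> 'w" assume *: "\<forall>k<n. \<omega> k = \<omega>' k"
  have "state_at M x0 \<omega> t = state_at M x0 \<omega>' t" if "t \<le> n" for t
    using that * by (intro state_at_cong) auto
  moreover have "cost_sum M x0 n \<omega> = cost_sum M x0 n \<omega>'"
    using adapted_cost_sum[of M x0] * by (auto simp: adapted_def)
  ultimately show "stopped_cost_sum M x0 n \<omega> = stopped_cost_sum M x0 n \<omega>'"
    by (auto simp: stopped_cost_sum_def)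
qed

lemma adapted_disc_sum:
  fixes M :: "('s, 'a, 'w) mdp"
  shows "adapted (disc_sum M \<xi> \<gamma> x0)"
  unfolding adapted_def disc_sum_def
proof safe
  fix n and \<omega> \<omega>' :: "nat \<Rightarrow> 'a \<times> 'w" assume *: "\<forall>k<n. \<omega> k = \<omega>' k"
  have "state_at M x0 \<omega> t = state_at M x0 \<omega>' t" if "t < n" for t
    using that * by (intro state_at_cong) auto
  then show "(\<Sum>t<n. ennreal (\<gamma> ^ t * (1 - \<gamma>) * h_d (\<xi> (state_at M x0 \<omega> t)))) =
    (\<Sum>t<n. ennreal (\<gamma> ^ t * (1 - \<gamma>) * h_d (\<xi> (state_at M x0 \<omega>' t))))"
    by (intro sum.cong) auto
qed

lemma J_obj_M_eq:
  fixes M :: "('s, 'a::countable, 'w::countable) mdp"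
  shows "J_obj_M M x0 \<pi> = prefix_value M x0 (cost_sum M x0) \<pi>"
  by (subst nn_integral_path_SUP[symmetric])
     (auto simp: J_obj_M_def suminf_eq_SUP cost_sum_def incseq_sum_ennreal adapted_cost_sum)

lemma J_cond_eq:
  fixes M :: "('s, 'a::countable, 'w::countable) mdp"
  shows "J_cond M \<xi> \<gamma> x0 \<pi> = prefix_value M x0 (disc_sum M \<xi> \<gamma> x0) \<pi>"
  by (subst nn_integral_path_SUP[symmetric])
     (auto simp: J_cond_def suminf_eq_SUP disc_sum_def incseq_sum_ennreal adapted_disc_sum)

lemma incseq_stopped_cost_sum: "incseq (\<lambda>n. stopped_cost_sum M x0 n \<omega>)"
proof (rule incseq_SucI)
  fix n
  have "cost_sum M x0 n \<omega> \<le> cost_sum M x0 (Suc n) \<omega>" by (simp add: cost_sum_def)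
  moreover have "\<exists>t\<le>Suc n. state_at M x0 \<omega> t = 0" if "\<exists>t\<le>n. state_at M x0 \<omega> t = 0"
    using that le_SucI by blast
  ultimately show "stopped_cost_sum M x0 n \<omega> \<le> stopped_cost_sum M x0 (Suc n) \<omega>"
    by (cases "\<exists>t\<le>n. state_at M x0 \<omega> t = 0") (simp_all only: stopped_cost_sum_def if_True if_False zero_le)
qed

lemma J_obj_S_eq:
  fixes M :: "(nat, 'a::countable, 'w::countable) mdp"
  shows "J_obj_S M x0 \<pi> = prefix_value M x0 (stopped_cost_sum M x0) \<pi>"
proof -
  have "indicator {\<omega>. \<exists>t. state_at M x0 \<omega> t = 0} \<omega> * (\<Sum>t. ennreal (cost_at M x0 \<omega> t)) =
      (SUP n. stopped_cost_sum M x0 n \<omega>)" (is "?l = _") for \<omega> :: "nat \<Rightarrow> 'a \<times> 'w"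
  proof (cases "\<exists>t. state_at M x0 \<omega> t = 0")
    case False
    then have "stopped_cost_sum M x0 n \<omega> = 0" for n
      unfolding stopped_cost_sum_def by metis
    with False show ?thesis by simp
  next
    case True
    then obtain t0 where t0: "state_at M x0 \<omega> t0 = 0" by auto
    have "(SUP n. cost_sum M x0 n \<omega>) = (SUP n. stopped_cost_sum M x0 n \<omega>)"
    proof (rule antisym)
      show "(SUP n. cost_sum M x0 n \<omega>) \<le> (SUP n. stopped_cost_sum M x0 n \<omega>)"
      proof (rule SUP_mono)
        fix n
        have "cost_sum M x0 n \<omega> \<le> cost_sum M x0 (max n t0) \<omega>"
          unfolding cost_sum_def by (intro sum_mono2) auto
        also have "\<dots> = stopped_cost_sum M x0 (max n t0) \<omega>"
          unfolding stopped_cost_sum_def using t0 by (metis max.cobounded2)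
        finally show "\<exists>m\<in>UNIV. cost_sum M x0 n \<omega> \<le> stopped_cost_sum M x0 m \<omega>" by auto
      qed
      show "(SUP n. stopped_cost_sum M x0 n \<omega>) \<le> (SUP n. cost_sum M x0 n \<omega>)"
        by (rule SUP_mono) (auto simp: stopped_cost_sum_def)
    qed
    with True show ?thesis by (simp add: suminf_eq_SUP cost_sum_def)
  qed
  then show ?thesis
    unfolding J_obj_S_def
    by (subst nn_integral_path_SUP[symmetric])
       (auto simp: adapted_stopped_cost_sum incseq_stopped_cost_sum)
qed

section \<open>Minimax for two criteria\<close>

text \<open>\<open>P\<close> carries no topology; the compactness is that of the values in
  \<open>ennreal\<close>. Along a subsequence of a minimizing sequence both criteria converge, and
  \<open>closed\<close> supplies a policy at least as good as the limits. A general
  \<open>\<phi>\<close> covers the maximum of the criteria as well as their weighted sums.\<close>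

lemma INF_attained_by_sequential_compactness:
  fixes a b :: "'p \<Rightarrow> ennreal" and \<phi> :: "ennreal \<Rightarrow> ennreal \<Rightarrow> ennreal"
  assumes ne: "P \<noteq> {}"
    and closed: "\<And>X A B. (\<And>n::nat. X n \<in> P) \<Longrightarrow> (\<lambda>n. a (X n)) \<longlonglongrightarrow> A \<Longrightarrow> (\<lambda>n. b (X n)) \<longlonglongrightarrow> B
      \<Longrightarrow> \<exists>\<pi>\<in>P. a \<pi> \<le> A \<and> b \<pi> \<le> B"
    and mono: "\<And>A A' B B'. A \<le> A' \<Longrightarrow> B \<le> B' \<Longrightarrow> \<phi> A B \<le> \<phi> A' B'"
    and cont: "\<And>X Y A B. X \<longlonglongrightarrow> A \<Longrightarrow> Y \<longlonglongrightarrow> B \<Longrightarrow> (\<lambda>n::nat. \<phi> (X n) (Y n)) \<longlonglongrightarrow> \<phi> A B"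
  shows "(INF \<pi>\<in>P. \<phi> (a \<pi>) (b \<pi>)) \<in> (\<lambda>\<pi>. \<phi> (a \<pi>) (b \<pi>)) ` P"
proof -
  let ?I = "INF \<pi>\<in>P. \<phi> (a \<pi>) (b \<pi>)"
  obtain u where u: "\<And>n. u n \<in> (\<lambda>\<pi>. \<phi> (a \<pi>) (b \<pi>)) ` P" "u \<longlonglongrightarrow> ?I"
    using Inf_as_limit[of "(\<lambda>\<pi>. \<phi> (a \<pi>) (b \<pi>)) ` P"] ne by auto
  then obtain X where X: "\<And>n. X n \<in> P" "\<And>n. u n = \<phi> (a (X n)) (b (X n))"
    unfolding image_iff by metis
  obtain A r where r: "strict_mono (r::nat \<Rightarrow> nat)" "((\<lambda>n. a (X n)) \<circ> r) \<longlonglongrightarrow> A"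
    using compact_complete_linorder by blast
  obtain B r' where r': "strict_mono (r'::nat \<Rightarrow> nat)" "((\<lambda>n. b (X (r n))) \<circ> r') \<longlonglongrightarrow> B"
    using compact_complete_linorder by blast
  have A: "(\<lambda>n. a (X (r (r' n)))) \<longlonglongrightarrow> A"
    using LIMSEQ_subseq_LIMSEQ[OF r(2) r'(1)] by (simp add: o_def)
  have B: "(\<lambda>n. b (X (r (r' n)))) \<longlonglongrightarrow> B"
    using r'(2) by (simp add: o_def)
  obtain \<pi> where \<pi>: "\<pi> \<in> P" "a \<pi> \<le> A" "b \<pi> \<le> B"
    using closed[OF X(1) A B] by auto
  have "(\<lambda>n. u (r (r' n))) \<longlonglongrightarrow> ?I"
    using LIMSEQ_subseq_LIMSEQ[OF LIMSEQ_subseq_LIMSEQ[OF u(2) r(1)] r'(1)] by (simp add: o_def)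
  then have "\<phi> A B = ?I"
    using cont[OF A B] X(2) by (simp add: LIMSEQ_unique)
  then have "\<phi> (a \<pi>) (b \<pi>) \<le> ?I"
    using mono[OF \<pi>(2,3)] by simp
  moreover have "?I \<le> \<phi> (a \<pi>) (b \<pi>)"
    by (rule INF_lower[OF \<pi>(1)])
  ultimately have "?I = \<phi> (a \<pi>) (b \<pi>)" by (rule antisym[rotated])
  then show ?thesis using \<pi>(1) by (rule image_eqI)
qed

text \<open>A weighted mean never exceeds the maximum. At an endpoint the criterion of weight 0
  drops out even if it is infinite, so the maximum is attained there.\<close>

lemma SUP_weights:
  fixes A B :: ennreal
  shows "(SUP \<alpha>\<in>weights. ennreal (fst \<alpha>) * A + ennreal (snd \<alpha>) * B) = max A B"
    and "(SUP \<alpha>\<in>weights. ennreal (fst \<alpha>) * A + ennreal (snd \<alpha>) * B)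
      \<in> (\<lambda>\<alpha>. ennreal (fst \<alpha>) * A + ennreal (snd \<alpha>) * B) ` weights"
proof -
  let ?f = "\<lambda>\<alpha>. ennreal (fst \<alpha>) * A + ennreal (snd \<alpha>) * B"
  have w: "(1, 0) \<in> weights" "(0, 1) \<in> weights" by (auto simp: weights_def)
  show eq: "(SUP \<alpha>\<in>weights. ?f \<alpha>) = max A B"
  proof (rule antisym)
    show "(SUP \<alpha>\<in>weights. ?f \<alpha>) \<le> max A B"
    proof (rule SUP_least)
      fix \<alpha> assume "\<alpha> \<in> weights"
      then have *: "0 \<le> fst \<alpha>" "0 \<le> snd \<alpha>" "fst \<alpha> + snd \<alpha> = 1" by (auto simp: weights_def)
      have "?f \<alpha> \<le> ennreal (fst \<alpha>) * max A B + ennreal (snd \<alpha>) * max A B"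
        by (intro add_mono mult_left_mono) auto
      also have "\<dots> = max A B"
        using * by (simp flip: distrib_right ennreal_plus)
      finally show "?f \<alpha> \<le> max A B" .
    qed
    show "max A B \<le> (SUP \<alpha>\<in>weights. ?f \<alpha>)"
      using SUP_upper[OF w(1), of ?f] SUP_upper[OF w(2), of ?f] by simp
  qed
  have "max A B = ?f (1, 0) \<or> max A B = ?f (0, 1)" by (auto simp: max_def)
  then show "(SUP \<alpha>\<in>weights. ?f \<alpha>) \<in> ?f ` weights"
    unfolding eq using w by blast
qed

text \<open>A line separates \<open>C\<close> from the open quadrant below the corner
  \<open>(V, V)\<close>. The quadrant is unbounded to the left and downwards, which forces a
  nonnegative normal vector; scaling its sum to 1 yields weights.\<close>

lemma supporting_weights:
  fixes C :: "(real \<times> real) set" and V :: real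
  assumes "convex C" "C \<noteq> {}"
    and above: "\<And>s t. (s, t) \<in> C \<Longrightarrow> V \<le> s \<or> V \<le> t"
  obtains \<alpha> where "\<alpha> \<in> weights" "\<And>s t. (s, t) \<in> C \<Longrightarrow> V \<le> fst \<alpha> * s + snd \<alpha> * t"
proof -
  let ?S = "{..<V} \<times> {..<V}"
  have "\<exists>n \<beta>. n \<noteq> 0 \<and> (\<forall>z\<in>?S. n \<bullet> z \<le> \<beta>) \<and> (\<forall>z\<in>C. \<beta> \<le> n \<bullet> z)"
  proof (rule separating_hyperplane_sets)
    show "convex ?S" by (intro convex_Times convex_real_interval)
    show "?S \<noteq> {}" using lt_ex[of V] by auto
    show "?S \<inter> C = {}" using above by fastforce
  qed (use assms in auto)
  then obtain n \<beta> where n: "n \<noteq> 0" and S: "\<And>z. z \<in> ?S \<Longrightarrow> n \<bullet> z \<le> \<beta>"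
    and C: "\<And>z. z \<in> C \<Longrightarrow> \<beta> \<le> n \<bullet> z" by blast
  obtain p q where pq: "n = (p, q)" by (cases n)
  have S': "p * s + q * t \<le> \<beta>" if "s < V" "t < V" for s t
    using S[of "(s, t)"] that by (simp add: pq)
  have "0 \<le> p"
  proof (rule ccontr)
    assume "\<not> 0 \<le> p"
    then have p: "p < 0" by simp
    \<comment> \<open>Going left by \<open>k\<close> from \<open>(V - 1, V - 1)\<close> raises the
      linear functional by \<open>k * (- p)\<close>, which is enough to exceed
      \<open>\<beta>\<close>, and the point stays in the quadrant.\<close>
    define k where "k = max 1 ((\<beta> - (p + q) * (V - 1)) / (- p) + 1)"
    have "(\<beta> - (p + q) * (V - 1)) / (- p) < k" "1 \<le> k" by (auto simp: k_def)
    then have "\<beta> - (p + q) * (V - 1) < k * (- p)"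
      using p by (simp only: pos_divide_less_eq neg_0_less_iff_less)
    moreover have "p * (V - 1 - k) + q * (V - 1) \<le> \<beta>" using \<open>1 \<le> k\<close> by (intro S') auto
    ultimately show False by (simp add: algebra_simps)
  qed
  moreover have "0 \<le> q"
  proof (rule ccontr)
    assume "\<not> 0 \<le> q"
    then have p: "q < 0" by simp
    define k where "k = max 1 ((\<beta> - (p + q) * (V - 1)) / (- q) + 1)"
    have "(\<beta> - (p + q) * (V - 1)) / (- q) < k" "1 \<le> k" by (auto simp: k_def)
    then have "\<beta> - (p + q) * (V - 1) < k * (- q)"
      using p by (simp only: pos_divide_less_eq neg_0_less_iff_less)
    moreover have "p * (V - 1) + q * (V - 1 - k) \<le> \<beta>" using \<open>1 \<le> k\<close> by (intro S') auto
    ultimately show False by (simp add: algebra_simps)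
  qed
  moreover have "p + q \<noteq> 0" using n pq calculation by (auto simp: zero_prod_def)
  ultimately have pos: "0 < p + q" and nonneg: "0 \<le> p" "0 \<le> q" by auto
  have V: "(p + q) * V \<le> \<beta>"
  proof (rule field_le_epsilon)
    fix e :: real assume "0 < e"
    \<comment> \<open>The corner is not in the open quadrant, so it is approached along the diagonal
      with a step that costs exactly \<open>e\<close>.\<close>
    have "p * (V - e / (p + q)) + q * (V - e / (p + q)) \<le> \<beta>"
      using \<open>0 < e\<close> pos by (intro S') auto
    moreover have "p * (V - e / (p + q)) + q * (V - e / (p + q)) = (p + q) * V - (p + q) * (e / (p + q))"
      by (simp only: distrib_right right_diff_distrib)
    ultimately show "(p + q) * V \<le> \<beta> + e" using pos by simp
  qed
  show ?thesis
  proof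
    show "(p / (p + q), q / (p + q)) \<in> weights"
      using pos nonneg by (auto simp: weights_def simp flip: add_divide_distrib)
    fix s t assume "(s, t) \<in> C"
    then have "(p + q) * V \<le> p * s + q * t" using C[of "(s, t)"] V by (simp add: pq)
    then have "V \<le> (p * s + q * t) / (p + q)" using pos by (simp add: pos_le_divide_eq mult.commute)
    then show "V \<le> fst (p / (p + q), q / (p + q)) * s + snd (p / (p + q), q / (p + q)) * t"
      by (simp add: add_divide_distrib)
  qed
qed

text \<open>The last hypothesis takes care of the weight vector \<open>(0, 1)\<close>: because \<open>0 * \<infinity> = 0\<close>, it ignores an
  infinite first criterion, while the separating line only controls policies with \<open>a \<pi> < \<infinity>\<close>.\<close>

lemma minimax_equality_two_criteria:
  fixes a b :: "'p \<Rightarrow> ennreal"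
  assumes ne: "P \<noteq> {}"
    and closed: "\<And>X A B. (\<And>n::nat. X n \<in> P) \<Longrightarrow> (\<lambda>n. a (X n)) \<longlonglongrightarrow> A \<Longrightarrow> (\<lambda>n. b (X n)) \<longlonglongrightarrow> B
      \<Longrightarrow> \<exists>\<pi>\<in>P. a \<pi> \<le> A \<and> b \<pi> \<le> B"
    and conv: "\<And>\<pi>1 \<pi>2 l. \<pi>1 \<in> P \<Longrightarrow> \<pi>2 \<in> P \<Longrightarrow> 0 \<le> l \<Longrightarrow> l \<le> 1 \<Longrightarrow>
      \<exists>\<pi>\<in>P. a \<pi> \<le> ennreal l * a \<pi>1 + ennreal (1 - l) * a \<pi>2 \<and> b \<pi> \<le> ennreal l * b \<pi>1 + ennreal (1 - l) * b \<pi>2"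
    and fin: "\<And>\<pi>. \<pi> \<in> P \<Longrightarrow> b \<pi> < top"
    and approx: "\<And>\<pi> \<delta>. \<pi> \<in> P \<Longrightarrow> 0 < \<delta> \<Longrightarrow> \<exists>\<pi>'\<in>P. a \<pi>' < top \<and> b \<pi>' \<le> b \<pi> + ennreal \<delta>"
  shows "minimax_equality P weights (\<lambda>\<alpha> \<pi>. ennreal (fst \<alpha>) * a \<pi> + ennreal (snd \<alpha>) * b \<pi>)"
proof -
  let ?J = "\<lambda>\<alpha> \<pi>. ennreal (fst \<alpha>) * a \<pi> + ennreal (snd \<alpha>) * b \<pi>"
  define V where "V = (INF \<pi>\<in>P. max (a \<pi>) (b \<pi>))"
  have V_attained: "V \<in> (\<lambda>\<pi>. max (a \<pi>) (b \<pi>)) ` P"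
    unfolding V_def
    by (rule INF_attained_by_sequential_compactness[OF ne closed]) (auto intro: tendsto_max simp: le_max_iff_disj)
  have V_le: "V \<le> max (a \<pi>) (b \<pi>)" if "\<pi> \<in> P" for \<pi>
    unfolding V_def using that by (rule INF_lower)
  \<comment> \<open>\<open>approx\<close> with error 1 turns an arbitrary policy into one of finite
    first criterion, which makes \<open>V\<close> a real number.\<close>
  obtain \<pi>0 where \<pi>0: "\<pi>0 \<in> P" "a \<pi>0 < top" using ne approx[of _ 1] by force
  have "V \<le> max (a \<pi>0) (b \<pi>0)" by (rule V_le[OF \<pi>0(1)])
  also have "\<dots> < top" using \<pi>0 fin by (simp add: max_def)
  finally have V_fin: "V < top" .
  define v where "v = enn2real V"
  have v: "V = ennreal v" "0 \<le> v" using V_fin by (auto simp: v_def)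
  \<comment> \<open>Dominated pairs are included so that the inequalities in \<open>conv\<close>
    give convexity. Real coordinates leave out the policies with infinite first criterion.\<close>
  define C where "C = {(s, t). 0 \<le> s \<and> 0 \<le> t \<and> (\<exists>\<pi>\<in>P. a \<pi> \<le> ennreal s \<and> b \<pi> \<le> ennreal t)}"
  have C_convex: "convex C"
  proof (rule convexI)
    fix z z' and k l :: real
    assume z: "z \<in> C" "z' \<in> C" and kl: "0 \<le> k" "0 \<le> l" "k + l = 1"
    obtain s t where st: "z = (s, t)" by (cases z)
    obtain s' t' where st': "z' = (s', t')" by (cases z')
    obtain \<pi> where \<pi>: "\<pi> \<in> P" "a \<pi> \<le> ennreal s" "b \<pi> \<le> ennreal t" and p: "0 \<le> s" "0 \<le> t"
      using z(1) by (auto simp: st C_def)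
    obtain \<pi>' where \<pi>': "\<pi>' \<in> P" "a \<pi>' \<le> ennreal s'" "b \<pi>' \<le> ennreal t'" and p': "0 \<le> s'" "0 \<le> t'"
      using z(2) by (auto simp: st' C_def)
    obtain \<rho> where \<rho>: "\<rho> \<in> P" "a \<rho> \<le> ennreal k * a \<pi> + ennreal l * a \<pi>'"
        "b \<rho> \<le> ennreal k * b \<pi> + ennreal l * b \<pi>'"
    proof -
      have "1 - k = l" "k \<le> 1" using kl by auto
      then show ?thesis using conv[OF \<pi>(1) \<pi>'(1) kl(1)] that by auto
    qed
    have "a \<rho> \<le> ennreal k * ennreal s + ennreal l * ennreal s'"
      using \<rho>(2) \<pi>(2) \<pi>'(2) by (meson add_mono mult_left_mono order_trans zero_le)
    moreover have "b \<rho> \<le> ennreal k * ennreal t + ennreal l * ennreal t'"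
      using \<rho>(3) \<pi>(3) \<pi>'(3) by (meson add_mono mult_left_mono order_trans zero_le)
    ultimately have "a \<rho> \<le> ennreal (k * s + l * s')" "b \<rho> \<le> ennreal (k * t + l * t')"
      using kl p p' by (simp_all add: ennreal_mult)
    then show "k *\<^sub>R z + l *\<^sub>R z' \<in> C"
      using \<rho>(1) kl p p' by (auto simp: st st' C_def)
  qed
  have "(enn2real (a \<pi>0), enn2real (b \<pi>0)) \<in> C"
    using \<pi>0 fin by (auto simp: C_def intro!: bexI[of _ \<pi>0])
  then have C_ne: "C \<noteq> {}" by blast
  have C_above: "v \<le> s \<or> v \<le> t" if "(s, t) \<in> C" for s t
  proof -
    from that obtain \<pi> where \<pi>: "\<pi> \<in> P" "a \<pi> \<le> ennreal s" "b \<pi> \<le> ennreal t" and st: "0 \<le> s" "0 \<le> t"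
      by (auto simp: C_def)
    have "ennreal v \<le> ennreal s \<or> ennreal v \<le> ennreal t"
      using V_le[OF \<pi>(1)] \<pi>(2,3) unfolding v(1) by (auto simp: le_max_iff_disj)
    then show ?thesis using st by simp
  qed
  obtain \<alpha> where \<alpha>: "\<alpha> \<in> weights" "\<And>s t. (s, t) \<in> C \<Longrightarrow> v \<le> fst \<alpha> * s + snd \<alpha> * t"
    using supporting_weights[OF C_convex C_ne C_above] by blast
  have \<alpha>': "0 \<le> fst \<alpha>" "0 \<le> snd \<alpha>" "fst \<alpha> + snd \<alpha> = 1" using \<alpha>(1) by (auto simp: weights_def)
  have finite_case: "V \<le> ?J \<alpha> \<pi>" if "\<pi> \<in> P" "a \<pi> < top" for \<pi>
  proof -
    define s t where "s = enn2real (a \<pi>)" and "t = enn2real (b \<pi>)"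
    have s: "a \<pi> = ennreal s" "0 \<le> s" and t: "b \<pi> = ennreal t" "0 \<le> t"
      using that fin by (auto simp: s_def t_def)
    have "(s, t) \<in> C" using s t that(1) by (auto simp: C_def intro!: bexI[of _ \<pi>])
    then have "v \<le> fst \<alpha> * s + snd \<alpha> * t" by (rule \<alpha>(2))
    then have "ennreal v \<le> ennreal (fst \<alpha> * s + snd \<alpha> * t)" by (rule ennreal_leI)
    then show ?thesis using s t \<alpha>' by (simp add: v(1) ennreal_mult)
  qed
  have lower: "V \<le> ?J \<alpha> \<pi>" if "\<pi> \<in> P" for \<pi>
  proof (cases "a \<pi> < top")
    case True
    then show ?thesis using finite_case that by blast
  next
    case False
    then have a: "a \<pi> = top" using top.not_eq_extremum by blast
    show ?thesis
    proof (cases "fst \<alpha> = 0")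
      case False
      then show ?thesis using \<alpha>'(1) by (simp add: a ennreal_mult_top)
    next
      case True
      then have 1: "snd \<alpha> = 1" using \<alpha>' by simp
      have "V \<le> b \<pi>"
      proof (rule ennreal_le_epsilon)
        fix \<delta> :: real assume "0 < \<delta>"
        then obtain \<pi>' where \<pi>': "\<pi>' \<in> P" "a \<pi>' < top" "b \<pi>' \<le> b \<pi> + ennreal \<delta>"
          using approx \<open>\<pi> \<in> P\<close> by blast
        show "V \<le> b \<pi> + ennreal \<delta>"
          using finite_case[OF \<pi>'(1,2)] \<pi>'(3) by (simp add: True 1)
      qed
      then show ?thesis by (simp add: True 1)
    qed
  qed
  have sup: "(SUP \<alpha>\<in>weights. ?J \<alpha> \<pi>) = max (a \<pi>) (b \<pi>)" for \<pi>
    by (rule SUP_weights)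
  have weak: "(INF \<pi>\<in>P. ?J \<beta> \<pi>) \<le> V" if "\<beta> \<in> weights" for \<beta>
    unfolding V_def sup[symmetric]
  proof (rule INF_mono)
    fix m assume "m \<in> P"
    then show "\<exists>\<pi>\<in>P. ?J \<beta> \<pi> \<le> (SUP \<alpha>\<in>weights. ?J \<alpha> m)"
      by (intro bexI[of _ m] SUP_upper2[OF that]) auto
  qed
  have \<alpha>_eq: "(INF \<pi>\<in>P. ?J \<alpha> \<pi>) = V"
    by (intro antisym weak \<alpha>(1) INF_greatest lower)
  have sup_eq: "(SUP \<beta>\<in>weights. INF \<pi>\<in>P. ?J \<beta> \<pi>) = V"
  proof (rule antisym)
    show "(SUP \<beta>\<in>weights. INF \<pi>\<in>P. ?J \<beta> \<pi>) \<le> V" by (intro SUP_least weak)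
    show "V \<le> (SUP \<beta>\<in>weights. INF \<pi>\<in>P. ?J \<beta> \<pi>)"
      using SUP_upper[OF \<alpha>(1), of "\<lambda>\<beta>. INF \<pi>\<in>P. ?J \<beta> \<pi>"] by (simp add: \<alpha>_eq)
  qed
  show ?thesis
    unfolding minimax_equality_def sup_eq unfolding sup V_def[symmetric]
  proof (intro conjI ballI)
    show "max (a \<pi>) (b \<pi>) \<in> (\<lambda>\<alpha>. ?J \<alpha> \<pi>) ` weights" for \<pi>
      using SUP_weights(2)[of "a \<pi>" "b \<pi>"] unfolding sup .
    show "(INF \<pi>\<in>P. ?J \<beta> \<pi>) \<in> (\<lambda>\<pi>. ?J \<beta> \<pi>) ` P" for \<beta>
      by (rule INF_attained_by_sequential_compactness[OF ne closed])
        (auto intro!: add_mono mult_left_mono tendsto_add ennreal_tendsto_cmult)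
    show "V \<in> (\<lambda>\<beta>. INF \<pi>\<in>P. ?J \<beta> \<pi>) ` weights"
      using \<alpha>(1) \<alpha>_eq by force
  qed (use V_attained in auto)
qed

section \<open>Convexity and compactness of the policies\<close>

lemma pmf_bind_map_inj:
  assumes "\<And>x y x' y'. h x y = h x' y' \<longleftrightarrow> x = x' \<and> y = y'"
  shows "pmf (bind_pmf p (\<lambda>x. map_pmf (h x) (q x))) (h x y) = pmf p x * pmf (q x) y"
proof -
  have inj: "inj (h x')" for x' using assms by (auto simp: inj_def)
  have "pmf (bind_pmf p (\<lambda>x. map_pmf (h x) (q x))) (h x y) =
      (\<integral>x'. pmf (map_pmf (h x') (q x')) (h x y) \<partial>measure_pmf p)"
    by (rule pmf_bind)
  also have "\<dots> = (\<Sum>x'\<in>{x}. pmf p x' *\<^sub>R pmf (map_pmf (h x') (q x')) (h x y))"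
    by (rule integral_measure_pmf) (auto simp: pmf_eq_0_set_pmf assms)
  also have "\<dots> = pmf p x * pmf (q x) y"
    by (simp add: pmf_map_inj'[OF inj])
  finally show ?thesis .
qed

definition action_weight :: "('s, 'a) policy \<Rightarrow> ('s \<times> real \<times> 'a) list \<Rightarrow> real" where
  "action_weight \<pi> l = (\<Prod>k<length l. case l ! k of (s, r, u) \<Rightarrow> pmf (\<pi> (take k l, (s, r))) u)"

lemma action_weight_Nil [simp]: "action_weight \<pi> [] = 1"
  by (simp add: action_weight_def)

lemma action_weight_snoc [simp]:
  "action_weight \<pi> (l @ [(s, r, u)]) = action_weight \<pi> l * pmf (\<pi> (l, (s, r))) u"
  unfolding action_weight_def by (simp add: nth_append)

lemma action_weight_nonneg: "0 \<le> action_weight \<pi> l"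
  unfolding action_weight_def by (intro prod_nonneg) (auto split: prod.split)

lemma hist_at_snoc:
  "hist_at M x0 ((!) (a @ [z])) (length a) = hist_at M x0 ((!) a) (length a)"
  "state_at M x0 ((!) (a @ [z])) (length a) = state_at M x0 ((!) a) (length a)"
  by (auto intro!: hist_at_cong state_at_cong simp: nth_append)

lemma fst_hist_at_snoc:
  "fst (hist_at M x0 ((!) (a @ [z])) (Suc (length a))) =
     fst (hist_at M x0 ((!) a) (length a)) @
       [(fst (snd (hist_at M x0 ((!) a) (length a))), snd (snd (hist_at M x0 ((!) a) (length a))), fst z)]"
proof -
  have "fst (hist_at M x0 ((!) (a @ [z])) (Suc (length a))) =
      fst (hist_at M x0 ((!) (a @ [z])) (length a)) @
       [(fst (snd (hist_at M x0 ((!) (a @ [z])) (length a))), snd (snd (hist_at M x0 ((!) (a @ [z])) (length a))), fst z)]"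
    by (simp add: hist_at_def nth_append)
  then show ?thesis by (simp only: hist_at_snoc)
qed

definition disturbance_weight :: "('s, 'a, 'w) mdp \<Rightarrow> 's \<Rightarrow> ('a \<times> 'w) list \<Rightarrow> real" where
  "disturbance_weight M x0 a =
     (\<Prod>k<length a. pmf (disturbance M (state_at M x0 ((!) a) k) (fst (a ! k))) (snd (a ! k)))"

lemma disturbance_weight_snoc:
  "disturbance_weight M x0 (a @ [z]) =
     disturbance_weight M x0 a * pmf (disturbance M (state_at M x0 ((!) a) (length a)) (fst z)) (snd z)"
proof -
  have "state_at M x0 ((!) (a @ [z])) k = state_at M x0 ((!) a) k" if "k \<le> length a" for k
    using that by (auto intro!: state_at_cong simp: nth_append)
  then show ?thesis by (simp add: disturbance_weight_def nth_append)
qed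

lemma pmf_prefix_step:
  "pmf (prefix_step M \<pi> x0 a) (u, w) =
     pmf (\<pi> (hist_at M x0 ((!) a) (length a))) u *
     pmf (disturbance M (state_at M x0 ((!) a) (length a)) u) w"
  unfolding prefix_step_def by (rule pmf_bind_map_inj) auto

lemma pmf_prefix_snoc:
  "pmf (prefix_pmf M \<pi> x0 (Suc n)) (a @ [z]) = pmf (prefix_pmf M \<pi> x0 n) a * pmf (prefix_step M \<pi> x0 a) z"
  by simp (rule pmf_bind_map_inj, auto)

lemma pmf_prefix_eq_0: "length a \<noteq> n \<Longrightarrow> pmf (prefix_pmf M \<pi> x0 n) a = 0"
  using length_prefix_pmf[of a M \<pi> x0 n] by (auto simp: pmf_eq_0_set_pmf)

lemma pmf_prefix:
  "pmf (prefix_pmf M \<pi> x0 (length a)) a =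
     action_weight \<pi> (fst (hist_at M x0 ((!) a) (length a))) * disturbance_weight M x0 a"
proof (induction a rule: rev_induct)
  case Nil
  then show ?case by (simp add: hist_at_def disturbance_weight_def)
next
  case (snoc z a)
  obtain u w where z: "z = (u, w)" by (cases z)
  show ?case
    by (simp add: pmf_prefix_snoc snoc fst_hist_at_snoc disturbance_weight_snoc pmf_prefix_step z del: prefix_pmf.simps)
qed

text \<open>The law of a prefix is a factor depending only on the disturbances times the factor
  \<open>action_weight\<close>, which is a function of the observed history. So randomizing once between two
  policies can be imitated by a single policy that uses the posterior probability of \<open>\<pi>1\<close>
  given the history. On histories of weight \<open>A + B = 0\<close> the choice does not matter.\<close>

definition mix_policy :: "real \<Rightarrow> ('s, 'a) policy \<Rightarrow> ('s, 'a) policy \<Rightarrow> ('s, 'a) policy" where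
  "mix_policy l \<pi>1 \<pi>2 h =
     (let A = l * action_weight \<pi>1 (fst h); B = (1 - l) * action_weight \<pi>2 (fst h)
      in bind_pmf (bernoulli_pmf (A / (A + B))) (\<lambda>b. if b then \<pi>1 h else \<pi>2 h))"

lemma mix_policy_in_policies:
  "\<pi>1 \<in> policies M \<Longrightarrow> \<pi>2 \<in> policies M \<Longrightarrow> mix_policy l \<pi>1 \<pi>2 \<in> policies M"
proof -
  assume *: "\<pi>1 \<in> policies M" "\<pi>2 \<in> policies M"
  have "set_pmf (mix_policy l \<pi>1 \<pi>2 h) \<subseteq> set_pmf (\<pi>1 h) \<union> set_pmf (\<pi>2 h)" for h
    by (auto simp: mix_policy_def Let_def split: if_splits)
  with * show ?thesis unfolding policies_def by blast
qed

text \<open>By Bayes, \<open>A\<close> and \<open>B\<close> are the joint weights of having drawn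
  \<open>\<pi>1\<close> or \<open>\<pi>2\<close> and having seen the history. Choosing with the
  posterior multiplies \<open>A\<close> by the next action probability under \<open>\<pi>1\<close>
  and \<open>B\<close> by that under \<open>\<pi>2\<close>, which is the induction step.\<close>

lemma action_weight_mix:
  assumes l: "0 \<le> l" "l \<le> 1"
  shows "action_weight (mix_policy l \<pi>1 \<pi>2) hs = l * action_weight \<pi>1 hs + (1 - l) * action_weight \<pi>2 hs"
proof (induction hs rule: rev_induct)
  case Nil
  then show ?case by simp
next
  case (snoc z hs)
  obtain s r u where z: "z = (s, r, u)" by (cases z)
  define A B where "A = l * action_weight \<pi>1 hs" and "B = (1 - l) * action_weight \<pi>2 hs"
  have AB: "0 \<le> A" "0 \<le> B" using l by (auto simp: A_def B_def action_weight_nonneg)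
  have q: "0 \<le> A / (A + B)" "A / (A + B) \<le> 1" using AB by (auto simp: divide_le_eq_1)
  define \<theta> where "\<theta> = A / (A + B)"
  have mix: "pmf (mix_policy l \<pi>1 \<pi>2 (hs, (s, r))) u =
      \<theta> * pmf (\<pi>1 (hs, (s, r))) u + (1 - \<theta>) * pmf (\<pi>2 (hs, (s, r))) u"
    using q by (simp add: mix_policy_def Let_def pmf_bind flip: A_def B_def \<theta>_def)
  have "(A + B) * pmf (mix_policy l \<pi>1 \<pi>2 (hs, (s, r))) u =
      (A + B) * \<theta> * pmf (\<pi>1 (hs, (s, r))) u + ((A + B) - (A + B) * \<theta>) * pmf (\<pi>2 (hs, (s, r))) u"
    unfolding mix by (simp only: algebra_simps)
  \<comment> \<open>If \<open>A + B = 0\<close>, nonnegativity gives \<open>A = 0\<close>, so the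
    identity survives the division by zero in \<open>\<theta>\<close>.\<close>
  also have "(A + B) * \<theta> = A" using AB by (cases "A + B = 0") (auto simp: \<theta>_def)
  finally show ?case by (simp add: z snoc algebra_simps flip: A_def B_def) (simp add: A_def B_def algebra_simps)
qed

lemma nn_integral_prefix_mix:
  assumes l: "0 \<le> l" "l \<le> 1"
  shows "(\<integral>\<^sup>+a. F a \<partial>prefix_pmf M (mix_policy l \<pi>1 \<pi>2) x0 n) =
    ennreal l * (\<integral>\<^sup>+a. F a \<partial>prefix_pmf M \<pi>1 x0 n) + ennreal (1 - l) * (\<integral>\<^sup>+a. F a \<partial>prefix_pmf M \<pi>2 x0 n)"
proof -
  have pmf: "pmf (prefix_pmf M (mix_policy l \<pi>1 \<pi>2) x0 n) a =
      l * pmf (prefix_pmf M \<pi>1 x0 n) a + (1 - l) * pmf (prefix_pmf M \<pi>2 x0 n) a" for a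
  proof (cases "length a = n")
    case True
    then show ?thesis by (auto simp: pmf_prefix action_weight_mix[OF l] algebra_simps)
  qed (simp add: pmf_prefix_eq_0)
  have "ennreal (pmf (prefix_pmf M (mix_policy l \<pi>1 \<pi>2) x0 n) a) * F a =
      ennreal l * (ennreal (pmf (prefix_pmf M \<pi>1 x0 n) a) * F a) +
      ennreal (1 - l) * (ennreal (pmf (prefix_pmf M \<pi>2 x0 n) a) * F a)" for a
    using l by (simp add: pmf ennreal_mult distrib_right mult.assoc)
  then show ?thesis
    by (simp add: nn_integral_measure_pmf nn_integral_add nn_integral_cmult)
qed

lemma prefix_value_mix:
  assumes l: "0 \<le> l" "l \<le> 1"
  shows "prefix_value M x0 G (mix_policy l \<pi>1 \<pi>2) \<le>
    ennreal l * prefix_value M x0 G \<pi>1 + ennreal (1 - l) * prefix_value M x0 G \<pi>2"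
  unfolding prefix_value_def nn_integral_prefix_mix[OF l]
  by (intro SUP_least add_mono mult_left_mono SUP_upper) auto

text \<open>Histories contain real numbers, but only countably many arise from prefixes, so one
  diagonal subsequence makes all action probabilities on them converge. The action set is finite, so
  no mass is lost and the limits sum to 1. The probability of a prefix is a finite product of such
  probabilities and fixed disturbance probabilities.\<close>

lemma policies_sequentially_compact:
  fixes M :: "('s, 'a::countable, 'w::countable) mdp"
  assumes fin: "finite (actions M)" and ne: "actions M \<noteq> {}" and X: "\<And>n. X n \<in> policies M"
  shows "\<exists>r \<pi>. strict_mono (r :: nat \<Rightarrow> nat) \<and> \<pi> \<in> policies M \<and>
    (\<forall>n a. (\<lambda>k. pmf (prefix_pmf M (X (r k)) x0 n) a) \<longlonglongrightarrow> pmf (prefix_pmf M \<pi> x0 n) a)"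
proof -
  define S where "S = range (\<lambda>a :: ('a \<times> 'w) list. hist_at M x0 ((!) a) (length a))"
  have "countable (S \<times> (UNIV :: 'a set))" by (auto simp: S_def)
  then obtain r where r: "strict_mono (r :: nat \<Rightarrow> nat)"
    and "\<And>z. z \<in> S \<times> UNIV \<Longrightarrow> \<exists>l. (\<lambda>n. pmf (X (r n) (fst z)) (snd z)) \<longlonglongrightarrow> l"
    by (rule function_convergent_subsequence[of "S \<times> UNIV" "\<lambda>n z. pmf (X n (fst z)) (snd z)" 1])
       (auto simp: pmf_le_1)
  then have "\<forall>h u. \<exists>l. h \<in> S \<longrightarrow> (\<lambda>n. pmf (X (r n) h) u) \<longlonglongrightarrow> l" by force
  then obtain L where L: "\<And>h u. h \<in> S \<Longrightarrow> (\<lambda>n. pmf (X (r n) h) u) \<longlonglongrightarrow> L h u" by metis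
  have supp: "set_pmf (X n h) \<subseteq> actions M" for n h using X[of n] unfolding policies_def by blast
  obtain u0 where u0: "u0 \<in> actions M" using ne by auto
  \<comment> \<open>Histories outside \<open>S\<close> never occur from \<open>x0\<close>; a fixed
    action there keeps the limit policy admissible.\<close>
  define \<pi> where "\<pi> h = (if h \<in> S then embed_pmf (L h) else return_pmf u0)" for h
  have L_nonneg: "0 \<le> L h u" if "h \<in> S" for h u
    using L[OF that] by (rule LIMSEQ_le_const) auto
  have L_0: "L h u = 0" if "h \<in> S" "u \<notin> actions M" for h u
  proof -
    have "pmf (X (r n) h) u = 0" for n using supp[of "r n" h] that(2) by (auto simp: pmf_eq_0_set_pmf)
    then show ?thesis using L[OF that(1), of u] by (simp add: LIMSEQ_const_iff)
  qed
  have L_sum: "(\<Sum>u\<in>actions M. L h u) = 1" if "h \<in> S" for h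
  proof -
    have "(\<lambda>n. \<Sum>u\<in>actions M. pmf (X (r n) h) u) \<longlonglongrightarrow> (\<Sum>u\<in>actions M. L h u)"
      by (intro tendsto_sum L that)
    moreover have "(\<Sum>u\<in>actions M. pmf (X (r n) h) u) = 1" for n
      by (rule sum_pmf_eq_1[OF fin supp])
    ultimately show ?thesis by (simp add: LIMSEQ_const_iff)
  qed
  have L_prob: "(\<integral>\<^sup>+u. ennreal (L h u) \<partial>count_space UNIV) = 1" if "h \<in> S" for h
  proof -
    have "(\<integral>\<^sup>+u. ennreal (L h u) \<partial>count_space UNIV) = (\<Sum>u\<in>actions M. ennreal (L h u))"
      by (rule nn_integral_count_space') (auto simp: fin L_0[OF that])
    also have "\<dots> = 1" using L_sum[OF that] L_nonneg[OF that] by (simp add: sum_ennreal)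
    finally show ?thesis .
  qed
  have pmf_\<pi>: "pmf (\<pi> h) u = L h u" if "h \<in> S" for h u
    using that by (simp add: \<pi>_def pmf_embed_pmf[OF L_nonneg L_prob])
  have "\<pi> \<in> policies M"
    unfolding policies_def
  proof safe
    fix h u assume u: "u \<in> set_pmf (\<pi> h)"
    show "u \<in> actions M"
    proof (cases "h \<in> S")
      case True
      then show ?thesis using u L_0[OF True, of u] pmf_\<pi>[OF True, of u] by (auto simp: set_pmf_iff)
    next
      case False
      then show ?thesis using u u0 by (simp add: \<pi>_def)
    qed
  qed
  moreover have "(\<lambda>k. pmf (prefix_pmf M (X (r k)) x0 n) a) \<longlonglongrightarrow> pmf (prefix_pmf M \<pi> x0 n) a" for n a
  proof (cases "length a = n")
    case False
    then show ?thesis by (simp add: pmf_prefix_eq_0)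
  next
    case True
    have "(\<lambda>k. pmf (prefix_pmf M (X (r k)) x0 (length a)) a) \<longlonglongrightarrow> pmf (prefix_pmf M \<pi> x0 (length a)) a"
    proof (induction a rule: rev_induct)
      case Nil
      then show ?case by simp
    next
      case (snoc z a)
      obtain u w where z: "z = (u, w)" by (cases z)
      have h: "hist_at M x0 ((!) a) (length a) \<in> S" by (auto simp: S_def)
      show ?case
        using snoc L[OF h, of u] h by (auto simp: pmf_prefix_snoc pmf_prefix_step z pmf_\<pi> simp del: prefix_pmf.simps intro!: tendsto_intros)
    qed
    with True show ?thesis by simp
  qed
  ultimately show ?thesis using r by blast
qed

text \<open>Fatou's lemma for the counting measure on prefixes. Finiteness of \<open>G\<close> makes
  the integrands converge, as it excludes a vanishing probability times infinity.\<close>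

lemma prefix_value_lower_semicontinuous:
  assumes fin: "\<And>n a. G n a < top"
    and lim: "\<And>n a. (\<lambda>k. pmf (prefix_pmf M (X k) x0 n) a) \<longlonglongrightarrow> pmf (prefix_pmf M \<pi> x0 n) a"
    and A: "(\<lambda>k. prefix_value M x0 G (X k)) \<longlonglongrightarrow> A"
  shows "prefix_value M x0 G \<pi> \<le> A"
  unfolding prefix_value_def
proof (rule SUP_least)
  fix n
  have "(\<lambda>k. ennreal (pmf (prefix_pmf M (X k) x0 n) a) * G n ((!) a))
      \<longlonglongrightarrow> ennreal (pmf (prefix_pmf M \<pi> x0 n) a) * G n ((!) a)" for a
    using ennreal_tendsto_cmult[OF fin[of n "(!) a"] tendsto_ennrealI[OF lim]] by (simp add: mult.commute)
  then have liminf: "liminf (\<lambda>k. ennreal (pmf (prefix_pmf M (X k) x0 n) a) * G n ((!) a)) =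
      ennreal (pmf (prefix_pmf M \<pi> x0 n) a) * G n ((!) a)" for a
    by (simp add: lim_imp_Liminf)
  have "(\<integral>\<^sup>+a. G n ((!) a) \<partial>prefix_pmf M \<pi> x0 n) =
      (\<integral>\<^sup>+a. liminf (\<lambda>k. ennreal (pmf (prefix_pmf M (X k) x0 n) a) * G n ((!) a)) \<partial>count_space UNIV)"
    by (simp add: liminf nn_integral_measure_pmf)
  also have "\<dots> \<le> liminf (\<lambda>k. \<integral>\<^sup>+a. ennreal (pmf (prefix_pmf M (X k) x0 n) a) * G n ((!) a) \<partial>count_space UNIV)"
    by (rule nn_integral_liminf) simp
  also have "\<dots> = liminf (\<lambda>k. \<integral>\<^sup>+a. G n ((!) a) \<partial>prefix_pmf M (X k) x0 n)"
    by (simp add: nn_integral_measure_pmf)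
  also have "\<dots> \<le> liminf (\<lambda>k. prefix_value M x0 G (X k))"
    unfolding prefix_value_def by (intro Liminf_mono always_eventually allI SUP_upper UNIV_I)
  also have "\<dots> = A" using A by (simp add: lim_imp_Liminf)
  finally show "(\<integral>\<^sup>+a. G n ((!) a) \<partial>prefix_pmf M \<pi> x0 n) \<le> A" .
qed

lemma prefix_values_closed:
  fixes M :: "('s, 'a::countable, 'w::countable) mdp"
  assumes "finite (actions M)" "actions M \<noteq> {}" and X: "\<And>n::nat. X n \<in> policies M"
    and fin: "\<And>n \<omega>. G n \<omega> < top" "\<And>n \<omega>. H n \<omega> < top"
    and A: "(\<lambda>n. prefix_value M x0 G (X n)) \<longlonglongrightarrow> A" and B: "(\<lambda>n. prefix_value M x0 H (X n)) \<longlonglongrightarrow> B"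
  shows "\<exists>\<pi>\<in>policies M. prefix_value M x0 G \<pi> \<le> A \<and> prefix_value M x0 H \<pi> \<le> B"
proof -
  obtain r \<pi> where r: "strict_mono (r :: nat \<Rightarrow> nat)" and \<pi>: "\<pi> \<in> policies M"
    "\<And>n a. (\<lambda>k. pmf (prefix_pmf M (X (r k)) x0 n) a) \<longlonglongrightarrow> pmf (prefix_pmf M \<pi> x0 n) a"
    using policies_sequentially_compact[where X=X and ?x0.0=x0, OF assms(1,2) X] by blast
  have AB: "(\<lambda>n. prefix_value M x0 G (X (r n))) \<longlonglongrightarrow> A" "(\<lambda>n. prefix_value M x0 H (X (r n))) \<longlonglongrightarrow> B"
    using LIMSEQ_subseq_LIMSEQ[OF A r] LIMSEQ_subseq_LIMSEQ[OF B r] by (simp_all add: o_def)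
  show ?thesis
    using prefix_value_lower_semicontinuous[where G=G, OF fin(1) \<pi>(2) AB(1)]
      prefix_value_lower_semicontinuous[where G=H, OF fin(2) \<pi>(2) AB(2)] \<pi>(1) by (intro bexI conjI)
qed

section \<open>Potentials along a controlled process\<close>

lemma nn_integral_pmf_le:
  assumes "\<And>x. x \<in> set_pmf p \<Longrightarrow> \<phi> x \<le> c"
  shows "(\<integral>\<^sup>+x. \<phi> x \<partial>measure_pmf p) \<le> (c :: ennreal)"
proof -
  have "(\<integral>\<^sup>+x. \<phi> x \<partial>measure_pmf p) \<le> (\<integral>\<^sup>+x. c \<partial>measure_pmf p)"
    by (rule nn_integral_mono_AE) (auto simp: AE_measure_pmf_iff assms)
  then show ?thesis by simp
qed

lemma nn_integral_pmf_ge: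
  assumes "\<And>x. x \<in> set_pmf p \<Longrightarrow> c \<le> \<phi> x"
  shows "(c :: ennreal) \<le> (\<integral>\<^sup>+x. \<phi> x \<partial>measure_pmf p)"
proof -
  have "(\<integral>\<^sup>+x. c \<partial>measure_pmf p) \<le> (\<integral>\<^sup>+x. \<phi> x \<partial>measure_pmf p)"
    by (rule nn_integral_mono_AE) (auto simp: AE_measure_pmf_iff assms)
  then show ?thesis by simp
qed

lemma state_at_append: "t \<le> length a \<Longrightarrow> state_at M x0 ((!) (a @ b)) t = state_at M x0 ((!) a) t"
  by (intro state_at_cong) (auto simp: nth_append)

lemma state_at_snoc_last:
  "state_at M x0 ((!) (a @ [z])) (Suc (length a)) = trans M (state_at M x0 ((!) a) (length a)) (fst z) (snd z)"
  by (simp add: state_at_append)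

text \<open>\<open>U\<close> restricts the actions that may be chosen at time \<open>t\<close> in
  state \<open>s\<close>, and \<open>I\<close> is an invariant of the visited states. A potential
  inequality for a controlled process then has to be verified only under \<open>I\<close> and
  \<open>U\<close>.\<close>

locale invariant_process =
  fixes M :: "('s, 'a, 'w) mdp" and \<pi> :: "('s, 'a) policy" and x0 :: 's
    and U :: "nat \<Rightarrow> 's \<Rightarrow> 'a \<Rightarrow> bool" and I :: "nat \<Rightarrow> 's \<Rightarrow> bool"
  assumes policy: "\<And>h u. u \<in> set_pmf (\<pi> h) \<Longrightarrow> U (length (fst h)) (fst (snd h)) u"
    and init: "I 0 x0"
    and step: "\<And>t s u w. I t s \<Longrightarrow> U t s u \<Longrightarrow> w \<in> set_pmf (disturbance M s u) \<Longrightarrow> I (Suc t) (trans M s u w)"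
begin

lemma set_prefix_step:
  assumes "(u, w) \<in> set_pmf (prefix_step M \<pi> x0 a)"
  shows "U (length a) (state_at M x0 ((!) a) (length a)) u"
    "w \<in> set_pmf (disturbance M (state_at M x0 ((!) a) (length a)) u)"
  using assms policy[of u "hist_at M x0 ((!) a) (length a)"]
  by (auto simp: prefix_step_def hist_at_def)

lemma prefix_actions:
  assumes "a \<in> set_pmf (prefix_pmf M \<pi> x0 n)" "t < n"
  shows "U t (state_at M x0 ((!) a) t) (fst (a ! t)) \<and>
    snd (a ! t) \<in> set_pmf (disturbance M (state_at M x0 ((!) a) t) (fst (a ! t)))"
  using assms
proof (induction n arbitrary: a)
  case (Suc n)
  from Suc.prems obtain b u w where b: "b \<in> set_pmf (prefix_pmf M \<pi> x0 n)"
    "(u, w) \<in> set_pmf (prefix_step M \<pi> x0 b)" "a = b @ [(u, w)]" by auto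
  have len: "length b = n" using b(1) by (rule length_prefix_pmf)
  show ?case
  proof (cases "t < n")
    case True
    then have "state_at M x0 ((!) a) t = state_at M x0 ((!) b) t" "a ! t = b ! t"
      by (simp_all only: b(3) len state_at_append nth_append less_imp_le if_True)
    then show ?thesis using Suc.IH[OF b(1) True] by simp
  next
    case False
    then have t: "t = length b" using Suc.prems len by simp
    have "state_at M x0 ((!) a) t = state_at M x0 ((!) b) t" "a ! t = (u, w)"
      by (simp_all only: b(3) t state_at_append order_refl nth_append_length)
    then show ?thesis using set_prefix_step[OF b(2)] by (simp add: t)
  qed
qed simp

lemma prefix_states:
  assumes a: "a \<in> set_pmf (prefix_pmf M \<pi> x0 n)" and "t \<le> n"
  shows "I t (state_at M x0 ((!) a) t)"
  using \<open>t \<le> n\<close>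
proof (induction t)
  case 0
  then show ?case by (simp add: init)
next
  case (Suc t)
  then show ?case using prefix_actions[OF a, of t] step by simp
qed

text \<open>Cost paid so far plus potential: a supermartingale or submartingale when
  \<open>\<Psi>\<close> satisfies the corresponding Bellman inequality, as in
  \<open>run_value_le\<close> and \<open>run_value_ge\<close>.\<close>

definition run_value :: "(nat \<Rightarrow> 's \<Rightarrow> 'a \<Rightarrow> 'w \<Rightarrow> ennreal) \<Rightarrow> (nat \<Rightarrow> 's \<Rightarrow> ennreal) \<Rightarrow> nat \<Rightarrow> ('a \<times> 'w) list \<Rightarrow> ennreal" where
  "run_value \<kappa> \<Psi> n a = (\<Sum>t<n. \<kappa> t (state_at M x0 ((!) a) t) (fst (a ! t)) (snd (a ! t))) +
     \<Psi> n (state_at M x0 ((!) a) n)"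

lemma nn_integral_run_value_Suc:
  "(\<integral>\<^sup>+a. run_value \<kappa> \<Psi> (Suc n) a \<partial>prefix_pmf M \<pi> x0 (Suc n)) =
   (\<integral>\<^sup>+a. (\<Sum>t<n. \<kappa> t (state_at M x0 ((!) a) t) (fst (a ! t)) (snd (a ! t))) +
     (\<integral>\<^sup>+u. (\<integral>\<^sup>+w. \<kappa> n (state_at M x0 ((!) a) n) u w + \<Psi> (Suc n) (trans M (state_at M x0 ((!) a) n) u w)
         \<partial>disturbance M (state_at M x0 ((!) a) n) u) \<partial>\<pi> (hist_at M x0 ((!) a) n)) \<partial>prefix_pmf M \<pi> x0 n)"
proof -
  have "(\<integral>\<^sup>+z. run_value \<kappa> \<Psi> (Suc n) (a @ [z]) \<partial>prefix_step M \<pi> x0 a) =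
     (\<Sum>t<n. \<kappa> t (state_at M x0 ((!) a) t) (fst (a ! t)) (snd (a ! t))) +
     (\<integral>\<^sup>+u. (\<integral>\<^sup>+w. \<kappa> n (state_at M x0 ((!) a) n) u w + \<Psi> (Suc n) (trans M (state_at M x0 ((!) a) n) u w)
         \<partial>disturbance M (state_at M x0 ((!) a) n) u) \<partial>\<pi> (hist_at M x0 ((!) a) n))"
    if "a \<in> set_pmf (prefix_pmf M \<pi> x0 n)" for a
  proof -
    have len: "length a = n" using that by (rule length_prefix_pmf)
    have "run_value \<kappa> \<Psi> (Suc n) (a @ [z]) =
      (\<Sum>t<n. \<kappa> t (state_at M x0 ((!) a) t) (fst (a ! t)) (snd (a ! t))) +
      (\<kappa> n (state_at M x0 ((!) a) n) (fst z) (snd z) + \<Psi> (Suc n) (trans M (state_at M x0 ((!) a) n) (fst z) (snd z)))" for z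
    proof -
      have st: "state_at M x0 ((!) (a @ [z])) t = state_at M x0 ((!) a) t" if "t \<le> n" for t
        using that len by (simp only: state_at_append)
      have last: "state_at M x0 ((!) (a @ [z])) (Suc n) = trans M (state_at M x0 ((!) a) n) (fst z) (snd z)"
        using state_at_snoc_last[of M x0 a z] by (simp only: len)
      have nth: "(a @ [z]) ! t = (if t < n then a ! t else z)" if "t \<le> n" for t
        using that len by (auto simp: nth_append)
      show ?thesis
        unfolding run_value_def last by (simp add: st nth add.assoc)
    qed
    then show ?thesis
      by (simp add: nn_integral_add prefix_step_def len)
  qed
  then show ?thesis
    by (auto simp: AE_measure_pmf_iff intro!: nn_integral_cong_AE)
qed

lemma run_value_le:
  assumes "\<And>t s u. I t s \<Longrightarrow> U t s u \<Longrightarrow>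
    (\<integral>\<^sup>+w. \<kappa> t s u w + \<Psi> (Suc t) (trans M s u w) \<partial>disturbance M s u) \<le> \<Psi> t s"
  shows "(\<integral>\<^sup>+a. run_value \<kappa> \<Psi> n a \<partial>prefix_pmf M \<pi> x0 n) \<le> \<Psi> 0 x0"
proof (induction n)
  case 0
  then show ?case by (simp add: run_value_def)
next
  case (Suc n)
  have "(\<integral>\<^sup>+a. run_value \<kappa> \<Psi> (Suc n) a \<partial>prefix_pmf M \<pi> x0 (Suc n)) \<le>
      (\<integral>\<^sup>+a. run_value \<kappa> \<Psi> n a \<partial>prefix_pmf M \<pi> x0 n)"
    unfolding nn_integral_run_value_Suc unfolding run_value_def
  proof (rule nn_integral_mono_AE, unfold AE_measure_pmf_iff, intro ballI add_left_mono, rule nn_integral_pmf_le)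
    fix a u assume "a \<in> set_pmf (prefix_pmf M \<pi> x0 n)" "u \<in> set_pmf (\<pi> (hist_at M x0 ((!) a) n))"
    then show "(\<integral>\<^sup>+w. \<kappa> n (state_at M x0 ((!) a) n) u w + \<Psi> (Suc n) (trans M (state_at M x0 ((!) a) n) u w)
         \<partial>disturbance M (state_at M x0 ((!) a) n) u) \<le> \<Psi> n (state_at M x0 ((!) a) n)"
      using prefix_states[of a n n] policy[of u "hist_at M x0 ((!) a) n"]
      by (intro assms) (auto simp: hist_at_def)
  qed
  with Suc show ?case by (rule order_trans[rotated])
qed

lemma run_value_ge:
  assumes "\<And>t s u. I t s \<Longrightarrow> U t s u \<Longrightarrow>
    \<Psi> t s \<le> (\<integral>\<^sup>+w. \<kappa> t s u w + \<Psi> (Suc t) (trans M s u w) \<partial>disturbance M s u)"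
  shows "\<Psi> 0 x0 \<le> (\<integral>\<^sup>+a. run_value \<kappa> \<Psi> n a \<partial>prefix_pmf M \<pi> x0 n)"
proof (induction n)
  case 0
  then show ?case by (simp add: run_value_def)
next
  case (Suc n)
  have "(\<integral>\<^sup>+a. run_value \<kappa> \<Psi> n a \<partial>prefix_pmf M \<pi> x0 n) \<le>
      (\<integral>\<^sup>+a. run_value \<kappa> \<Psi> (Suc n) a \<partial>prefix_pmf M \<pi> x0 (Suc n))"
    unfolding nn_integral_run_value_Suc unfolding run_value_def
  proof (rule nn_integral_mono_AE, unfold AE_measure_pmf_iff, intro ballI add_left_mono, rule nn_integral_pmf_ge)
    fix a u assume "a \<in> set_pmf (prefix_pmf M \<pi> x0 n)" "u \<in> set_pmf (\<pi> (hist_at M x0 ((!) a) n))"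
    then show "\<Psi> n (state_at M x0 ((!) a) n) \<le>
        (\<integral>\<^sup>+w. \<kappa> n (state_at M x0 ((!) a) n) u w + \<Psi> (Suc n) (trans M (state_at M x0 ((!) a) n) u w)
         \<partial>disturbance M (state_at M x0 ((!) a) n) u)"
      using prefix_states[of a n n] policy[of u "hist_at M x0 ((!) a) n"]
      by (intro assms) (auto simp: hist_at_def)
  qed
  with Suc show ?case by (rule order_trans)
qed

text \<open>A verification lemma. Domination is asked only on prefixes of positive probability, so
  \<open>\<kappa>\<close> may charge nothing where the policy guarantees that the cost will not
  count.\<close>

lemma prefix_value_le_potential:
  assumes dom: "\<And>n a. a \<in> set_pmf (prefix_pmf M \<pi> x0 n) \<Longrightarrow>
      G n ((!) a) \<le> (\<Sum>t<n. \<kappa> t (state_at M x0 ((!) a) t) (fst (a ! t)) (snd (a ! t)))"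
    and pot: "\<And>t s u. I t s \<Longrightarrow> U t s u \<Longrightarrow>
      (\<integral>\<^sup>+w. \<kappa> t s u w + \<Psi> (Suc t) (trans M s u w) \<partial>disturbance M s u) \<le> \<Psi> t s"
  shows "prefix_value M x0 G \<pi> \<le> \<Psi> 0 x0"
  unfolding prefix_value_def
proof (rule SUP_least)
  fix n
  have "(\<integral>\<^sup>+a. G n ((!) a) \<partial>prefix_pmf M \<pi> x0 n) \<le> (\<integral>\<^sup>+a. run_value \<kappa> \<Psi> n a \<partial>prefix_pmf M \<pi> x0 n)"
    unfolding run_value_def
    by (intro nn_integral_mono_AE) (auto simp: AE_measure_pmf_iff intro!: add_increasing2 dom)
  also have "\<dots> \<le> \<Psi> 0 x0" using pot by (rule run_value_le)
  finally show "(\<integral>\<^sup>+a. G n ((!) a) \<partial>prefix_pmf M \<pi> x0 n) \<le> \<Psi> 0 x0" .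
qed

end

definition markov_policy :: "(nat \<Rightarrow> 's \<Rightarrow> 'a) \<Rightarrow> ('s, 'a) policy" where
  "markov_policy \<sigma> h = return_pmf (\<sigma> (length (fst h)) (fst (snd h)))"

section \<open>Discounted dynamic programming\<close>

locale terminal_mdp =
  fixes NX NC :: nat
    and p :: "nat \<Rightarrow> nat \<Rightarrow> ('w::countable) pmf"
    and f :: "nat \<Rightarrow> nat \<Rightarrow> 'w \<Rightarrow> nat"
    and g :: "nat \<Rightarrow> nat \<Rightarrow> 'w \<Rightarrow> real"
    and \<gamma> :: real
  assumes actions_nonempty: "1 \<le> NC"
    and closed: "\<And>y u w. y \<in> {0..NX} \<Longrightarrow> u \<in> {1..NC} \<Longrightarrow> f y u w \<in> {0..NX}"
    and cost_nonneg: "\<And>y u w. y \<in> {0..NX} \<Longrightarrow> u \<in> {1..NC} \<Longrightarrow> 0 \<le> g y u w"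
    and finite_mean: "\<And>y u. y \<in> {0..NX} \<Longrightarrow> u \<in> {1..NC} \<Longrightarrow> integrable (measure_pmf (p y u)) (g y u)"
    and terminal: "\<And>u w. u \<in> {1..NC} \<Longrightarrow> f 0 u w = 0 \<and> g 0 u w = 0"
    and gamma: "0 < \<gamma>" "\<gamma> < 1"
begin

text \<open>Value iteration from 0: \<open>dp n\<close> is the optimal discounted cost of horizon
  \<open>n\<close>, which ignores a tail of at most \<gamma>^n.\<close>

primrec dp :: "nat \<Rightarrow> nat \<Rightarrow> ennreal" where
  "dp 0 y = 0"
| "dp (Suc n) y = ennreal ((1 - \<gamma>) * h_d y) + ennreal \<gamma> * (INF u\<in>{1..NC}. \<integral>\<^sup>+w. dp n (f y u w) \<partial>p y u)"

lemma greedy_exists: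
  "\<exists>u. u \<in> {1..NC} \<and> (\<integral>\<^sup>+w. dp n (f y u w) \<partial>p y u) = (INF u\<in>{1..NC}. \<integral>\<^sup>+w. dp n (f y u w) \<partial>p y u)"
proof -
  let ?Q = "\<lambda>u. \<integral>\<^sup>+w. dp n (f y u w) \<partial>p y u"
  have ne: "finite (?Q ` {1..NC})" "?Q ` {1..NC} \<noteq> {}" using actions_nonempty by auto
  have "Inf (?Q ` {1..NC}) \<in> ?Q ` {1..NC}"
    using Min_in[OF ne] cInf_eq_Min[OF ne] by metis
  then show ?thesis by auto
qed

text \<open>The index is that of the continuation value: with \<open>Suc n\<close> steps to go the
  minimizing action is \<open>greedy n\<close>, hence \<open>greedy (T - Suc t)\<close> at time
  \<open>t\<close> under horizon \<open>T\<close>.\<close>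

definition greedy :: "nat \<Rightarrow> nat \<Rightarrow> nat" where
  "greedy n y = (SOME u. u \<in> {1..NC} \<and>
     (\<integral>\<^sup>+w. dp n (f y u w) \<partial>p y u) = (INF u\<in>{1..NC}. \<integral>\<^sup>+w. dp n (f y u w) \<partial>p y u))"

lemma greedy:
  "greedy n y \<in> {1..NC}"
  "(\<integral>\<^sup>+w. dp n (f y (greedy n y) w) \<partial>p y (greedy n y)) = (INF u\<in>{1..NC}. \<integral>\<^sup>+w. dp n (f y u w) \<partial>p y u)"
  using someI_ex[OF greedy_exists[where n=n and y=y]] unfolding greedy_def by blast+

lemma discounted_step:
  "ennreal (\<gamma> ^ t * (1 - \<gamma>) * h_d y) + ennreal (\<gamma> ^ Suc t) * c = ennreal (\<gamma> ^ t) * (ennreal ((1 - \<gamma>) * h_d y) + ennreal \<gamma> * c)"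
proof -
  have "ennreal (\<gamma> ^ t * (1 - \<gamma>) * h_d y) = ennreal (\<gamma> ^ t) * ennreal ((1 - \<gamma>) * h_d y)"
    using gamma by (subst ennreal_mult[symmetric]) (auto simp: h_d_def mult.assoc)
  moreover have "ennreal (\<gamma> ^ Suc t) = ennreal (\<gamma> ^ t) * ennreal \<gamma>"
    using gamma by (subst ennreal_mult[symmetric]) (auto simp: mult.commute)
  ultimately show ?thesis by (simp add: distrib_left mult.assoc)
qed

text \<open>\<open>\<xi>\<close> and \<open>\<nu>\<close> project to the original state and action,
  so that the original and the augmented process are treated at once. The discounted cost paid plus
  the potential \<open>\<gamma> ^ t * dp (n - t)\<close> is a submartingale, and the potential is 0
  at time \<open>n\<close>.\<close>

lemma dp_le_discounted:
  fixes M :: "('s, 'a, 'w) mdp"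
  assumes dist: "\<And>s a. disturbance M s a = p (\<xi> s) (\<nu> a)"
    and tr: "\<And>s a w. \<xi> (trans M s a w) = f (\<xi> s) (\<nu> a) w"
    and act: "\<And>a. a \<in> actions M \<Longrightarrow> \<nu> a \<in> {1..NC}"
    and \<pi>: "\<pi> \<in> policies M"
  shows "dp n (\<xi> x0) \<le> prefix_value M x0 (disc_sum M \<xi> \<gamma> x0) \<pi>"
proof -
  interpret invariant_process M \<pi> x0 "\<lambda>t s u. u \<in> actions M" "\<lambda>t s. True"
    using \<pi> by unfold_locales (auto simp: policies_def)
  let ?\<kappa> = "\<lambda>t s u w. ennreal (\<gamma> ^ t * (1 - \<gamma>) * h_d (\<xi> s))"
  let ?\<Psi> = "\<lambda>t s. ennreal (\<gamma> ^ t) * dp (n - t) (\<xi> s)"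
  have "?\<Psi> 0 x0 \<le> (\<integral>\<^sup>+a. run_value ?\<kappa> ?\<Psi> n a \<partial>prefix_pmf M \<pi> x0 n)"
  proof (rule run_value_ge)
    fix t s u assume u: "u \<in> actions M"
    show "?\<Psi> t s \<le> (\<integral>\<^sup>+w. ?\<kappa> t s u w + ?\<Psi> (Suc t) (trans M s u w) \<partial>disturbance M s u)"
    proof (cases "n - t")
      case 0
      then show ?thesis by simp
    next
      case (Suc m)
      then have m: "n - Suc t = m" by simp
      have "(INF u\<in>{1..NC}. \<integral>\<^sup>+w. dp m (f (\<xi> s) u w) \<partial>p (\<xi> s) u) \<le> (\<integral>\<^sup>+w. dp m (f (\<xi> s) (\<nu> u) w) \<partial>p (\<xi> s) (\<nu> u))"
        using act[OF u] by (rule INF_lower)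
      then have "?\<Psi> t s \<le> ennreal (\<gamma> ^ t) * (ennreal ((1 - \<gamma>) * h_d (\<xi> s)) +
          ennreal \<gamma> * (\<integral>\<^sup>+w. dp m (f (\<xi> s) (\<nu> u) w) \<partial>p (\<xi> s) (\<nu> u)))"
        unfolding Suc dp.simps by (intro mult_left_mono add_left_mono) auto
      also have "\<dots> = (\<integral>\<^sup>+w. ?\<kappa> t s u w + ?\<Psi> (Suc t) (trans M s u w) \<partial>disturbance M s u)"
        unfolding discounted_step[symmetric] dist tr m
        by (simp add: nn_integral_add nn_integral_cmult del: power_Suc)
      finally show ?thesis .
    qed
  qed
  also have "\<dots> = (\<integral>\<^sup>+a. disc_sum M \<xi> \<gamma> x0 n ((!) a) \<partial>prefix_pmf M \<pi> x0 n)"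
    by (simp add: run_value_def disc_sum_def)
  also have "\<dots> \<le> prefix_value M x0 (disc_sum M \<xi> \<gamma> x0) \<pi>"
    unfolding prefix_value_def by (rule SUP_upper) simp
  finally show ?thesis by simp
qed

text \<open>Before \<open>T\<close> greedy actions keep the Bellman equation exact. Afterwards the
  actions are arbitrary, and the whole tail costs at most \<gamma>^T.\<close>

lemma discounted_le_dp:
  fixes M :: "('s, 'a, 'w) mdp"
  assumes dist: "\<And>s a. disturbance M s a = p (\<xi> s) (\<nu> a)"
    and tr: "\<And>s a w. \<xi> (trans M s a w) = f (\<xi> s) (\<nu> a) w"
    and greedy_phase: "\<And>t s. t < T \<Longrightarrow> \<nu> (\<sigma> t s) = greedy (T - Suc t) (\<xi> s)"
  shows "prefix_value M x0 (disc_sum M \<xi> \<gamma> x0) (markov_policy \<sigma>) \<le> dp T (\<xi> x0) + ennreal (\<gamma> ^ T)"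
proof -
  interpret invariant_process M "markov_policy \<sigma>" x0 "\<lambda>t s u. u = \<sigma> t s" "\<lambda>t s. True"
    by unfold_locales (auto simp: markov_policy_def)
  let ?\<kappa> = "\<lambda>t s u w. ennreal (\<gamma> ^ t * (1 - \<gamma>) * h_d (\<xi> s))"
  \<comment> \<open>The second term is the reserve for the tail: it is untouched until
    \<open>T\<close> and then shrinks as \<gamma>^t, releasing (1 - \<gamma>) \<gamma>^t per
    step.\<close>
  let ?\<Psi> = "\<lambda>t s. ennreal (\<gamma> ^ t) * dp (T - t) (\<xi> s) + ennreal (\<gamma> ^ max t T)"
  have "prefix_value M x0 (disc_sum M \<xi> \<gamma> x0) (markov_policy \<sigma>) \<le> ?\<Psi> 0 x0"
  proof (rule prefix_value_le_potential[where \<kappa>="?\<kappa>"])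
    show "disc_sum M \<xi> \<gamma> x0 n ((!) a) \<le> (\<Sum>t<n. ?\<kappa> t (state_at M x0 ((!) a) t) (fst (a ! t)) (snd (a ! t)))" for n a
      by (simp add: disc_sum_def)
  next
    fix t s u assume u: "u = \<sigma> t s"
    show "(\<integral>\<^sup>+w. ?\<kappa> t s u w + ?\<Psi> (Suc t) (trans M s u w) \<partial>disturbance M s u) \<le> ?\<Psi> t s"
    proof (cases "t < T")
      case True
      define m where "m = T - Suc t"
      have m: "T - t = Suc m" "max (Suc t) T = T" "max t T = T" using True by (auto simp: m_def)
      have "(\<integral>\<^sup>+w. ?\<kappa> t s u w + ?\<Psi> (Suc t) (trans M s u w) \<partial>disturbance M s u) =
          (ennreal (\<gamma> ^ t * (1 - \<gamma>) * h_d (\<xi> s)) +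
           ennreal (\<gamma> ^ Suc t) * (\<integral>\<^sup>+w. dp m (f (\<xi> s) (\<nu> u) w) \<partial>p (\<xi> s) (\<nu> u))) + ennreal (\<gamma> ^ T)"
        unfolding dist tr m m_def[symmetric]
        by (simp add: nn_integral_add nn_integral_cmult add.assoc del: power_Suc)
      also have "\<dots> = ?\<Psi> t s"
        unfolding discounted_step u greedy_phase[OF True] m_def[symmetric] greedy(2) m dp.simps ..
      finally show ?thesis by simp
    next
      case False
      then have "T - t = 0" "T - Suc t = 0" "max (Suc t) T = Suc t" "max t T = t" by auto
      moreover have "\<gamma> ^ t * (1 - \<gamma>) * h_d (\<xi> s) + \<gamma> ^ Suc t \<le> \<gamma> ^ t"
        using gamma by (auto simp: h_d_def algebra_simps mult_le_cancel_left1)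
      ultimately show ?thesis
        using gamma by (simp del: power_Suc add: h_d_def flip: ennreal_plus split: if_splits)
    qed
  qed
  then show ?thesis by simp
qed

end

section \<open>Policies of finite cost\<close>

context terminal_mdp
begin

text \<open>A sum instead of a maximum: the means are nonnegative, so it bounds each of
  them.\<close>

definition mean_bound :: real where
  "mean_bound = (\<Sum>y\<in>{0..NX}. \<Sum>u\<in>{1..NC}. measure_pmf.expectation (p y u) (g y u))"

lemma expectation_cost_nonneg:
  assumes "y \<in> {0..NX}" "u \<in> {1..NC}"
  shows "0 \<le> measure_pmf.expectation (p y u) (g y u)"
  using cost_nonneg[OF assms] by (intro integral_nonneg_AE) auto

lemma mean_bound_nonneg: "0 \<le> mean_bound"
  unfolding mean_bound_def by (intro sum_nonneg expectation_cost_nonneg)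

lemma nn_integral_cost:
  assumes "y \<in> {0..NX}" "u \<in> {1..NC}"
  shows "(\<integral>\<^sup>+w. ennreal (g y u w) \<partial>p y u) = ennreal (measure_pmf.expectation (p y u) (g y u))"
  using finite_mean[OF assms] cost_nonneg[OF assms] by (intro nn_integral_eq_integral) auto

lemma expectation_cost_le:
  assumes yu: "y \<in> {0..NX}" "u \<in> {1..NC}"
  shows "measure_pmf.expectation (p y u) (g y u) \<le> mean_bound"
proof -
  have "measure_pmf.expectation (p y u) (g y u) \<le> (\<Sum>u\<in>{1..NC}. measure_pmf.expectation (p y u) (g y u))"
    using yu expectation_cost_nonneg by (intro member_le_sum[of u "{1..NC}" "\<lambda>u. measure_pmf.expectation (p y u) (g y u)"]) auto
  also have "\<dots> \<le> mean_bound"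
    unfolding mean_bound_def
    using yu expectation_cost_nonneg
    by (intro member_le_sum[of y "{0..NX}" "\<lambda>y. \<Sum>u\<in>{1..NC}. measure_pmf.expectation (p y u) (g y u)"] sum_nonneg) auto
  finally show ?thesis .
qed

lemma nn_integral_cost_le:
  assumes "y \<in> {0..NX}" "u \<in> {1..NC}"
  shows "(\<integral>\<^sup>+w. ennreal (g y u w) \<partial>p y u) \<le> ennreal mean_bound"
  using expectation_cost_le[OF assms] by (simp add: nn_integral_cost[OF assms] ennreal_leI)

text \<open>\<open>surely_reach n\<close> consists of the states from which every policy hits \<open>0\<close> within \<open>n\<close> steps with
  positive probability, and from \<open>avoiding\<close> state \<open>0\<close> can be avoided forever.\<close>

primrec surely_reach :: "nat \<Rightarrow> nat set" where
  "surely_reach 0 = {0}"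
| "surely_reach (Suc n) = surely_reach n \<union>
     {y \<in> {0..NX}. \<forall>u\<in>{1..NC}. \<exists>w\<in>set_pmf (p y u). f y u w \<in> surely_reach n}"

lemma surely_reach_mono: "m \<le> n \<Longrightarrow> surely_reach m \<subseteq> surely_reach n"
  by (rule lift_Suc_mono_le) auto

lemma surely_reach_subset: "surely_reach n \<subseteq> {0..NX}"
  by (induction n) auto

definition avoiding :: "nat set" where
  "avoiding = {0..NX} - (\<Union>n. surely_reach n)"

lemma zero_not_avoiding: "0 \<notin> avoiding"
  using surely_reach.simps(1) unfolding avoiding_def by blast

text \<open>If every action could lead into some \<open>surely_reach n\<close>, finitely many
  actions and monotonicity in \<open>n\<close> would give a common level \<open>m\<close>, and
  \<open>y\<close> itself would be in \<open>surely_reach (Suc m)\<close>.\<close>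

lemma avoiding_action_exists:
  assumes y: "y \<in> avoiding"
  shows "\<exists>u\<in>{1..NC}. \<forall>w\<in>set_pmf (p y u). f y u w \<in> avoiding"
proof (rule ccontr)
  assume neg: "\<not> ?thesis"
  have yX: "y \<in> {0..NX}" using y by (simp add: avoiding_def)
  have "\<exists>n. \<exists>w\<in>set_pmf (p y u). f y u w \<in> surely_reach n" if u: "u \<in> {1..NC}" for u
  proof -
    obtain w where "w \<in> set_pmf (p y u)" "f y u w \<notin> avoiding" using neg u by blast
    then show ?thesis using closed[OF yX u, of w] unfolding avoiding_def by blast
  qed
  then obtain n where n: "\<And>u. u \<in> {1..NC} \<Longrightarrow> \<exists>w\<in>set_pmf (p y u). f y u w \<in> surely_reach (n u)"
    by metis
  define m where "m = Max (n ` {1..NC})"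
  have "\<exists>w\<in>set_pmf (p y u). f y u w \<in> surely_reach m" if u: "u \<in> {1..NC}" for u
    using n[OF u] surely_reach_mono[of "n u" m] u by (auto simp: m_def)
  then have "y \<in> surely_reach (Suc m)" using yX by simp
  then show False using y unfolding avoiding_def by blast
qed

definition avoid :: "nat \<Rightarrow> nat" where
  "avoid y = (SOME u. u \<in> {1..NC} \<and> (\<forall>w\<in>set_pmf (p y u). f y u w \<in> avoiding))"

lemma avoid:
  assumes "y \<in> avoiding"
  shows "avoid y \<in> {1..NC}" "w \<in> set_pmf (p y (avoid y)) \<Longrightarrow> f y (avoid y) w \<in> avoiding"
proof -
  have "\<exists>u. u \<in> {1..NC} \<and> (\<forall>w\<in>set_pmf (p y u). f y u w \<in> avoiding)"
    using avoiding_action_exists[OF assms] by blast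
  from someI_ex[OF this] show "avoid y \<in> {1..NC}" "w \<in> set_pmf (p y (avoid y)) \<Longrightarrow> f y (avoid y) w \<in> avoiding"
    unfolding avoid_def by blast+
qed

text \<open>Outside \<open>avoiding\<close> every action moves with probability at least \<open>\<delta>\<close> to a state of smaller rank.
  The potential \<open>G (\<beta>\<^sup>N - \<beta>\<^bsup>N - rank y\<^esup>)\<close> with \<open>\<delta> \<beta> = 2\<close> drops so much on that event that it pays for
  one expected stage cost even if the state jumps to the top rank otherwise.\<close>

lemma lyapunov_exists:
  "\<exists>L B. B < top \<and> (\<forall>y. L y \<le> B) \<and> (\<forall>y\<in>avoiding. L y = 0) \<and>
    (\<forall>y\<in>{0..NX} - avoiding. \<forall>u\<in>{1..NC}. (\<integral>\<^sup>+w. ennreal (g y u w) + L (f y u w) \<partial>p y u) \<le> (L y :: ennreal))"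
proof -
  define R where "R = (\<Union>n. surely_reach n)"
  define rank where "rank y = (LEAST n. y \<in> surely_reach n)" for y
  have rank_in: "y \<in> surely_reach (rank y)" if "y \<in> R" for y
    using that unfolding R_def rank_def by (auto intro: LeastI)
  have rank_le: "rank y \<le> n" if "y \<in> surely_reach n" for y n
    using that unfolding rank_def by (rule Least_le)
  have R_sub: "R \<subseteq> {0..NX}" using surely_reach_subset by (auto simp: R_def)
  then have R_fin: "finite R" by (rule finite_subset) simp
  have zero_R: "0 \<in> R" unfolding R_def using surely_reach.simps(1) by blast
  have rank_0: "rank 0 = 0" using rank_le[of 0 0] by simp
  define N where "N = Max (rank ` R)"
  have rank_N: "rank y \<le> N" if "y \<in> R" for y
    unfolding N_def using R_fin that by (intro Max_ge) auto
  have descend: "\<exists>w\<in>set_pmf (p y u). f y u w \<in> R \<and> rank (f y u w) < rank y"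
    if y: "y \<in> R" "y \<noteq> 0" and u: "u \<in> {1..NC}" for y u
  proof (cases "rank y")
    case 0
    then show ?thesis using rank_in[OF y(1)] y(2) by simp
  next
    case (Suc m)
    have "y \<notin> surely_reach m" using rank_le[of y m] Suc by auto
    then have "\<forall>u\<in>{1..NC}. \<exists>w\<in>set_pmf (p y u). f y u w \<in> surely_reach m"
      using rank_in[OF y(1)] by (simp add: Suc)
    then obtain w where w: "w \<in> set_pmf (p y u)" "f y u w \<in> surely_reach m" using u by blast
    then have "f y u w \<in> R" "rank (f y u w) \<le> m" using rank_le by (auto simp: R_def)
    with w(1) Suc show ?thesis by auto
  qed
  then obtain wit where wit: "\<And>y u. y \<in> R \<Longrightarrow> y \<noteq> 0 \<Longrightarrow> u \<in> {1..NC} \<Longrightarrow>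
      wit y u \<in> set_pmf (p y u) \<and> f y u (wit y u) \<in> R \<and> rank (f y u (wit y u)) < rank y"
    by metis
  \<comment> \<open>Inserting 1 covers the case that 0 is the only state of \<open>R\<close>, and it
    gives \<open>\<delta> \<le> 1\<close>, hence \<open>\<beta> \<ge> 1\<close>.\<close>
  define D where "D = insert 1 ((\<lambda>(y, u). pmf (p y u) (wit y u)) ` ((R - {0}) \<times> {1..NC}))"
  define \<delta> where "\<delta> = Min D"
  have D: "finite D" "D \<noteq> {}" using R_fin by (auto simp: D_def)
  have \<delta>_le: "\<delta> \<le> pmf (p y u) (wit y u)" if "y \<in> R" "y \<noteq> 0" "u \<in> {1..NC}" for y u
    unfolding \<delta>_def using D(1) that by (intro Min_le) (auto simp: D_def)
  have "\<forall>d\<in>D. 0 < d" using wit by (auto simp: D_def pmf_positive_iff)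
  then have \<delta>_pos: "0 < \<delta>" using D by (simp add: \<delta>_def)
  have \<delta>_1: "\<delta> \<le> 1" unfolding \<delta>_def using D(1) by (intro Min_le) (auto simp: D_def)
  define \<beta> where "\<beta> = 2 / \<delta>"
  have \<beta>: "1 \<le> \<beta>" "\<delta> * \<beta> = 2" using \<delta>_pos \<delta>_1 by (auto simp: \<beta>_def le_divide_eq)
  let ?G = "mean_bound"
  define v where "v y = (if y \<in> R then ?G * (\<beta> ^ N - \<beta> ^ (N - rank y)) else 0)" for y
  have v_nonneg: "0 \<le> v y" for y
    using \<beta>(1) mean_bound_nonneg by (auto simp: v_def intro!: mult_nonneg_nonneg power_increasing)
  have v_le: "v y \<le> ?G * \<beta> ^ N" for y
    using \<beta>(1) mean_bound_nonneg by (auto simp: v_def intro!: mult_left_mono)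
  have main: "(\<integral>\<^sup>+w. ennreal (g y u w) + ennreal (v (f y u w)) \<partial>p y u) \<le> ennreal (v y)"
    if y: "y \<in> R" and u: "u \<in> {1..NC}" for y u
  proof (cases "y = 0")
    case True
    then show ?thesis using terminal[OF u] by (simp add: v_def rank_0)
  next
    case False
    have yX: "y \<in> {0..NX}" using y R_sub by auto
    define w0 where "w0 = wit y u"
    define q where "q = pmf (p y u) w0"
    have w0: "f y u w0 \<in> R" "rank (f y u w0) < rank y"
      using wit[OF y False u] by (auto simp: w0_def)
    have q: "\<delta> \<le> q" using \<delta>_le[OF y False u] by (simp add: q_def w0_def)
    obtain m where m: "rank y = Suc m" using w0(2) by (cases "rank y") auto
    have mN: "Suc m \<le> N" using rank_N[OF y] m by simp
    \<comment> \<open>The witness \<open>w0\<close> leads to rank at most \<open>m\<close>, so the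
      potential there lies at least \<open>c\<close> below the top level
      \<open>?G * \<beta> ^ N\<close>. Adding \<open>c\<close> at \<open>w0\<close> still respects
      that level, and integration yields a saving of \<open>c * q\<close>.\<close>
    define c where "c = ?G * \<beta> ^ (N - m)"
    have c: "0 \<le> c" using \<beta>(1) mean_bound_nonneg by (simp add: c_def)
    have "\<beta> ^ (N - m) \<le> \<beta> ^ (N - rank (f y u w0))"
      using \<beta>(1) w0(2) m by (intro power_increasing) auto
    then have v_w0: "v (f y u w0) + c \<le> ?G * \<beta> ^ N"
      using w0(1) mean_bound_nonneg by (simp add: v_def c_def right_diff_distrib mult_left_mono)
    have "(\<integral>\<^sup>+w. ennreal (v (f y u w)) + ennreal c * indicator {w0} w \<partial>p y u) \<le> ennreal (?G * \<beta> ^ N)"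
    proof (rule nn_integral_pmf_le)
      fix w
      show "ennreal (v (f y u w)) + ennreal c * indicator {w0} w \<le> ennreal (?G * \<beta> ^ N)"
        using v_w0 v_le c v_nonneg
        by (cases "w = w0") (auto simp flip: ennreal_plus intro!: ennreal_leI)
    qed
    then have E: "(\<integral>\<^sup>+w. ennreal (v (f y u w)) \<partial>p y u) + ennreal c * ennreal q \<le> ennreal (?G * \<beta> ^ N)"
      by (simp add: nn_integral_add nn_integral_cmult_indicator emeasure_pmf_single q_def)
    define e where "e = enn2real (\<integral>\<^sup>+w. ennreal (v (f y u w)) \<partial>p y u)"
    have "(\<integral>\<^sup>+w. ennreal (v (f y u w)) \<partial>p y u) \<le> ennreal (?G * \<beta> ^ N)"
      by (rule order_trans[OF _ E]) simp
    then have "(\<integral>\<^sup>+w. ennreal (v (f y u w)) \<partial>p y u) < top"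
      using ennreal_less_top order.strict_trans1 by blast
    then have e: "(\<integral>\<^sup>+w. ennreal (v (f y u w)) \<partial>p y u) = ennreal e" "0 \<le> e"
      by (auto simp: e_def)
    have q0: "0 \<le> q" by (simp add: q_def)
    have G\<beta>: "0 \<le> ?G * \<beta> ^ N" using \<beta>(1) mean_bound_nonneg by simp
    have ecq: "e + c * q \<le> ?G * \<beta> ^ N"
      using E e c q0 G\<beta> by (simp flip: ennreal_mult ennreal_plus)
    have "c * \<delta> \<le> c * q" using q c by (rule mult_left_mono)
    \<comment> \<open>One half of \<open>c * \<delta>\<close> is the distance of \<open>v y\<close>
      from the top level; the other half is at least \<open>?G\<close> and pays for the stage cost.
      This is why \<open>\<delta> * \<beta>\<close> is 2.\<close>
    moreover have "c * \<delta> = 2 * (?G * \<beta> ^ (N - Suc m))"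
    proof -
      have "N - m = Suc (N - Suc m)" using mN by simp
      then have "c * \<delta> = ?G * \<beta> ^ (N - Suc m) * (\<delta> * \<beta>)" by (simp add: c_def)
      then show ?thesis by (simp add: \<beta>(2))
    qed
    moreover have "?G \<le> ?G * \<beta> ^ (N - Suc m)"
      using mult_left_mono[OF one_le_power[OF \<beta>(1)] mean_bound_nonneg] by simp
    ultimately have "?G + e \<le> v y"
      using ecq y m by (simp add: v_def right_diff_distrib)
    then have "measure_pmf.expectation (p y u) (g y u) + e \<le> v y"
      using expectation_cost_le[OF yX u] by simp
    then have "ennreal (measure_pmf.expectation (p y u) (g y u)) + ennreal e \<le> ennreal (v y)"
      using expectation_cost_nonneg[OF yX u] e(2) by (simp add: ennreal_leI flip: ennreal_plus)
    then show ?thesis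
      by (simp add: nn_integral_add nn_integral_cost[OF yX u] e(1))
  qed
  have "v y = 0" if "y \<in> avoiding" for y
    using that by (auto simp: avoiding_def R_def v_def)
  moreover have "{0..NX} - avoiding = R" using R_sub by (auto simp: avoiding_def R_def)
  moreover have "ennreal (v y) \<le> ennreal (?G * \<beta> ^ N)" for y using v_le by (rule ennreal_leI)
  ultimately show ?thesis
    using main by (intro exI[of _ "\<lambda>y. ennreal (v y)"] exI[of _ "ennreal (?G * \<beta> ^ N)"]) auto
qed

end

section \<open>Reduction of both cases to policies of finite objective\<close>

lemma sum_ennreal_less_top: "(\<Sum>t<n::nat. ennreal (c t)) < top"
  by (induction n) auto

lemma cost_sum_less_top: "cost_sum M x0 n \<omega> < top"
  unfolding cost_sum_def by (rule sum_ennreal_less_top)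

lemma stopped_cost_sum_less_top: "stopped_cost_sum M x0 n \<omega> < top"
  unfolding stopped_cost_sum_def using cost_sum_less_top by auto

lemma disc_sum_less_top: "disc_sum M \<xi> \<gamma> x0 n \<omega> < top"
  unfolding disc_sum_def by (rule sum_ennreal_less_top)

context terminal_mdp
begin

lemma disc_value_less_top:
  fixes M :: "('s, 'a, 'w) mdp"
  shows "prefix_value M x0 (disc_sum M \<xi> \<gamma> x0) \<pi> < top"
proof -
  have "prefix_value M x0 (disc_sum M \<xi> \<gamma> x0) \<pi> \<le> 1"
    unfolding prefix_value_def
  proof (intro SUP_least nn_integral_pmf_le)
    fix n a
    have "disc_sum M \<xi> \<gamma> x0 n ((!) a) = ennreal (\<Sum>t<n. \<gamma> ^ t * (1 - \<gamma>) * h_d (\<xi> (state_at M x0 ((!) a) t)))"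
      unfolding disc_sum_def using gamma by (intro sum_ennreal) (auto simp: h_d_def)
    also have "\<dots> \<le> ennreal (\<Sum>t<n. \<gamma> ^ t * (1 - \<gamma>))"
      using gamma by (intro ennreal_leI sum_mono) (auto simp: h_d_def)
    also have "(\<Sum>t<n. \<gamma> ^ t * (1 - \<gamma>)) = 1 - \<gamma> ^ n"
      by (simp add: one_diff_power_eq sum_distrib_left mult.commute)
    also have "ennreal (1 - \<gamma> ^ n) \<le> 1" using gamma by (simp add: ennreal_le_1)
    finally show "disc_sum M \<xi> \<gamma> x0 n ((!) a) \<le> 1" .
  qed
  also have "\<dots> < top" by simp
  finally show ?thesis .
qed

text \<open>The common core of both cases, with \<open>c\<close> in the role of \<eta>/\<epsilon>.
  For the policies provided by \<open>obj\<close>, \<open>dp T\<close> is at most \<gamma>^T below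
  the discounted condition, while it is a lower bound for that of every policy; a large
  \<open>T\<close> gives the approximation by finite objectives.\<close>

lemma minimax_equality_scalarize:
  fixes M :: "('s, 'a::countable, 'w) mdp"
  assumes dist: "\<And>s a. disturbance M s a = p (\<xi> s) (\<nu> a)"
    and tr: "\<And>s a w. \<xi> (trans M s a w) = f (\<xi> s) (\<nu> a) w"
    and act: "\<And>a. a \<in> actions M \<Longrightarrow> \<nu> a \<in> {1..NC}"
    and fin: "finite (actions M)" and ne: "actions M \<noteq> {}"
    and G: "\<And>n \<omega>. G n \<omega> < top"
    and obj: "\<And>T. \<exists>\<sigma>. markov_policy \<sigma> \<in> policies M \<and> prefix_value M x0 G (markov_policy \<sigma>) < top \<and>
      (\<forall>t s. t < T \<longrightarrow> \<nu> (\<sigma> t s) = greedy (T - Suc t) (\<xi> s))"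
    and c: "0 \<le> c"
  shows "minimax_equality (policies M) weights
    (\<lambda>\<alpha> \<pi>. ennreal (fst \<alpha>) * prefix_value M x0 G \<pi> +
       ennreal (c * snd \<alpha>) * prefix_value M x0 (disc_sum M \<xi> \<gamma> x0) \<pi>)"
proof -
  let ?a = "prefix_value M x0 G" and ?b = "\<lambda>\<pi>. ennreal c * prefix_value M x0 (disc_sum M \<xi> \<gamma> x0) \<pi>"
  \<comment> \<open>Moving the factor inside makes the scaled condition a
    \<open>prefix_value\<close> again.\<close>
  define H where "H n \<omega> = ennreal c * disc_sum M \<xi> \<gamma> x0 n \<omega>" for n \<omega>
  have H: "?b \<pi> = prefix_value M x0 H \<pi>" for \<pi>
    by (simp add: H_def prefix_value_def nn_integral_cmult SUP_mult_left_ennreal)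
  have "minimax_equality (policies M) weights (\<lambda>\<alpha> \<pi>. ennreal (fst \<alpha>) * ?a \<pi> + ennreal (snd \<alpha>) * ?b \<pi>)"
  proof (rule minimax_equality_two_criteria)
    show "policies M \<noteq> {}" using obj[of 0] by auto
    show "\<exists>\<pi>\<in>policies M. ?a \<pi> \<le> A \<and> ?b \<pi> \<le> B"
      if "\<And>n::nat. X n \<in> policies M" "(\<lambda>n. ?a (X n)) \<longlonglongrightarrow> A" "(\<lambda>n. ?b (X n)) \<longlonglongrightarrow> B" for X A B
      unfolding H
      by (rule prefix_values_closed[OF fin ne that(1) G _ that(2)])
         (use that(3) in \<open>simp_all add: H_def H ennreal_mult_less_top disc_sum_less_top\<close>)
    show "\<exists>\<pi>\<in>policies M. ?a \<pi> \<le> ennreal l * ?a \<pi>1 + ennreal (1 - l) * ?a \<pi>2 \<and>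
        ?b \<pi> \<le> ennreal l * ?b \<pi>1 + ennreal (1 - l) * ?b \<pi>2"
      if "\<pi>1 \<in> policies M" "\<pi>2 \<in> policies M" "0 \<le> l" "l \<le> 1" for \<pi>1 \<pi>2 l
      unfolding H using that by (intro bexI[of _ "mix_policy l \<pi>1 \<pi>2"] conjI prefix_value_mix mix_policy_in_policies)
    show "?b \<pi> < top" for \<pi>
      using disc_value_less_top[of M x0 \<xi> \<pi>] by (simp add: ennreal_mult_less_top)
    show "\<exists>\<pi>'\<in>policies M. ?a \<pi>' < top \<and> ?b \<pi>' \<le> ?b \<pi> + ennreal \<delta>" if \<pi>: "\<pi> \<in> policies M" and \<delta>: "0 < \<delta>" for \<pi> \<delta>
    proof -
      have "(\<lambda>T. c * \<gamma> ^ T) \<longlonglongrightarrow> c * 0"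
        using gamma by (intro tendsto_mult tendsto_const LIMSEQ_power_zero) auto
      then have "eventually (\<lambda>T. c * \<gamma> ^ T < \<delta>) sequentially"
        using \<delta> by (intro order_tendstoD(2)) auto
      then obtain T where T: "c * \<gamma> ^ T < \<delta>" by (auto simp: eventually_sequentially)
      obtain \<sigma> where \<sigma>: "markov_policy \<sigma> \<in> policies M" "?a (markov_policy \<sigma>) < top"
        "\<And>t s. t < T \<Longrightarrow> \<nu> (\<sigma> t s) = greedy (T - Suc t) (\<xi> s)"
        using obj[of T] by blast
      have "?b (markov_policy \<sigma>) \<le> ennreal c * (dp T (\<xi> x0) + ennreal (\<gamma> ^ T))"
        by (intro mult_left_mono discounted_le_dp[OF dist tr \<sigma>(3)]) auto
      also have "\<dots> \<le> ennreal c * (prefix_value M x0 (disc_sum M \<xi> \<gamma> x0) \<pi> + ennreal (\<gamma> ^ T))"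
        by (intro mult_left_mono add_right_mono dp_le_discounted[OF dist tr act \<pi>]) auto
      also have "\<dots> = ?b \<pi> + ennreal (c * \<gamma> ^ T)"
        using c by (simp add: distrib_left ennreal_mult')
      also have "\<dots> \<le> ?b \<pi> + ennreal \<delta>"
        using T by (intro add_left_mono ennreal_leI) auto
      finally show ?thesis using \<sigma>(1,2) by blast
    qed
  qed
  then show ?thesis
    using c by (simp add: ennreal_mult' mult.assoc mult.left_commute[of "ennreal c"])
qed

text \<open>Both policies below act greedily for the discounted criterion up to time \<open>T\<close> and avoid state \<open>0\<close>
  afterwards as soon as possible. Paths that enter \<open>avoiding\<close> after time \<open>T\<close> never reach \<open>0\<close>, so
  their cost does not count in case (S) and stops in case (M) by switching the mark to \<open>Mark_f\<close>.\<close>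

lemma stopped_cost_policy_exists:
  assumes x: "x \<in> {0..NX}"
  shows "\<exists>\<sigma>. markov_policy \<sigma> \<in> policies (base_mdp NC p f g) \<and>
    prefix_value (base_mdp NC p f g) x (stopped_cost_sum (base_mdp NC p f g) x) (markov_policy \<sigma>) < top \<and>
    (\<forall>t s. t < T \<longrightarrow> \<sigma> t s = greedy (T - Suc t) s)"
proof -
  let ?M = "base_mdp NC p f g"
  obtain L B where B: "B < (top :: ennreal)" and L_le: "\<And>y. L y \<le> B" and L_0: "\<And>y. y \<in> avoiding \<Longrightarrow> L y = 0"
    and L: "\<And>y u. y \<in> {0..NX} \<Longrightarrow> y \<notin> avoiding \<Longrightarrow> u \<in> {1..NC} \<Longrightarrow>
      (\<integral>\<^sup>+w. ennreal (g y u w) + L (f y u w) \<partial>p y u) \<le> L y"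
    using lyapunov_exists by blast
  define \<sigma> where "\<sigma> t y = (if t < T then greedy (T - Suc t) y else if y \<in> avoiding then avoid y else 1)" for t y
  have \<sigma>: "\<sigma> t y \<in> {1..NC}" for t y
    using greedy(1) avoid(1) actions_nonempty by (simp add: \<sigma>_def)
  \<comment> \<open>The greedy phase may leave \<open>avoiding\<close>, so before \<open>T\<close>
    all costs are charged. From \<open>T\<close> on a path in \<open>avoiding\<close> is trapped
    there and its cost is never credited.\<close>
  define \<kappa> where "\<kappa> t y u w = (if T \<le> t \<and> y \<in> avoiding then 0 else ennreal (g y u w))" for t y u w
  \<comment> \<open>Each remaining greedy step is paid by \<open>mean_bound\<close>, and
    \<open>B\<close> covers whatever value \<open>L\<close> has at time \<open>T\<close>.\<close>
  define \<Psi> where "\<Psi> t y = (if t < T then of_nat (T - t) * ennreal mean_bound + B else L y)" for t y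
  have \<Psi>_le: "\<Psi> t y \<le> of_nat (T - t) * ennreal mean_bound + B" for t y
    using L_le by (simp add: \<Psi>_def add_increasing)
  interpret invariant_process ?M "markov_policy \<sigma>" x "\<lambda>t y u. u = \<sigma> t y" "\<lambda>t y. y \<in> {0..NX}"
    using x closed \<sigma> by unfold_locales (auto simp: markov_policy_def base_mdp_def simp del: atLeastAtMost_iff)
  have "prefix_value ?M x (stopped_cost_sum ?M x) (markov_policy \<sigma>) \<le> \<Psi> 0 x"
  proof (rule prefix_value_le_potential[where \<kappa>=\<kappa>])
    fix n a assume a: "a \<in> set_pmf (prefix_pmf ?M (markov_policy \<sigma>) x n)"
    let ?s = "state_at ?M x ((!) a)"
    have next_state: "?s (Suc t) = f (?s t) (\<sigma> t (?s t)) (snd (a ! t))" if "t < n" for t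
      using prefix_actions[OF a that] by (simp add: base_mdp_def)
    have stay: "?s r \<in> avoiding" if "T \<le> t" "?s t \<in> avoiding" "t \<le> r" "r \<le> n" for t r
      using that(3,4)
    proof (induction r rule: dec_induct)
      case base
      then show ?case using that(2) by simp
    next
      case (step r)
      then have r: "?s r \<in> avoiding" "r < n" "\<not> r < T" using that(1) by auto
      have "snd (a ! r) \<in> set_pmf (p (?s r) (avoid (?s r)))"
        using prefix_actions[OF a r(2)] r by (auto simp: base_mdp_def \<sigma>_def)
      then show ?case
        using next_state[OF r(2)] avoid(2)[OF r(1)] r by (simp add: \<sigma>_def)
    qed
    have absorbed: "?s t = 0" if "?s r = 0" "r \<le> t" "t \<le> n" for r t
      using that(2,3)
    proof (induction t rule: dec_induct)
      case base
      then show ?case using that(1) by simp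
    next
      case (step t)
      then have "?s t = 0" "t < n" by auto
      then show ?case using next_state[of t] terminal[OF \<sigma>] by (simp del: state_at.simps)
    qed
    show "stopped_cost_sum ?M x n ((!) a) \<le> (\<Sum>t<n. \<kappa> t (?s t) (fst (a ! t)) (snd (a ! t)))"
    proof (cases "\<exists>t\<le>n. ?s t = 0")
      case False
      then show ?thesis unfolding stopped_cost_sum_def by (simp only: if_False zero_le)
    next
      case True
      then obtain r where r: "r \<le> n" "?s r = 0" by blast
      \<comment> \<open>A path that is at 0 at time \<open>r\<close> is never in
        \<open>avoiding\<close> from \<open>T\<close> on: up to \<open>r\<close> it would be trapped
        away from 0, after \<open>r\<close> it is absorbed at 0.\<close>
      have "?s t \<notin> avoiding" if "T \<le> t" "t < n" for t
      proof
        assume av: "?s t \<in> avoiding"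
        show False
        proof (cases "t \<le> r")
          case True
          then show False using stay[OF that(1) av True r(1)] r(2) zero_not_avoiding by simp
        next
          case False
          then show False using absorbed[OF r(2), of t] that(2) av zero_not_avoiding by simp
        qed
      qed
      then show ?thesis
        unfolding stopped_cost_sum_def cost_sum_def if_P[OF True]
        by (intro sum_mono) (auto simp: \<kappa>_def cost_at_def base_mdp_def)
    qed
  next
    fix t y u assume y: "y \<in> {0..NX}" and u: "u = \<sigma> t y"
    have uA: "u \<in> {1..NC}" using \<sigma> u by simp
    have "(\<integral>\<^sup>+w. \<kappa> t y u w + \<Psi> (Suc t) (f y u w) \<partial>p y u) \<le> \<Psi> t y"
    proof (cases "t < T")
      case True
      have "(\<integral>\<^sup>+w. \<kappa> t y u w + \<Psi> (Suc t) (f y u w) \<partial>p y u) \<le>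
          (\<integral>\<^sup>+w. ennreal (g y u w) + (of_nat (T - Suc t) * ennreal mean_bound + B) \<partial>p y u)"
        using True by (intro nn_integral_mono add_mono \<Psi>_le) (simp add: \<kappa>_def)
      also have "\<dots> = (\<integral>\<^sup>+w. ennreal (g y u w) \<partial>p y u) + (of_nat (T - Suc t) * ennreal mean_bound + B)"
        by (simp add: nn_integral_add)
      also have "\<dots> \<le> ennreal mean_bound + (of_nat (T - Suc t) * ennreal mean_bound + B)"
        by (intro add_right_mono nn_integral_cost_le y uA)
      also have "\<dots> = of_nat (Suc (T - Suc t)) * ennreal mean_bound + B"
        by (simp add: distrib_right add.assoc)
      also have "Suc (T - Suc t) = T - t" using True by simp
      finally show ?thesis using True by (simp add: \<Psi>_def)
    next
      case False
      show ?thesis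
      proof (cases "y \<in> avoiding")
        case True
        have "(\<integral>\<^sup>+w. \<kappa> t y u w + \<Psi> (Suc t) (f y u w) \<partial>p y u) \<le> 0"
          using False True avoid(2)[OF True] u
          by (intro nn_integral_pmf_le) (simp add: \<kappa>_def \<Psi>_def \<sigma>_def L_0)
        then show ?thesis by simp
      next
        case False': False
        then show ?thesis using L[OF y False' uA] False by (simp add: \<kappa>_def \<Psi>_def)
      qed
    qed
    then show "(\<integral>\<^sup>+w. \<kappa> t y u w + \<Psi> (Suc t) (trans ?M y u w) \<partial>disturbance ?M y u) \<le> \<Psi> t y"
      by (simp add: base_mdp_def)
  qed
  also have "\<dots> < top"
    by (rule order.strict_trans1[OF \<Psi>_le]) (use B in \<open>simp add: ennreal_mult_less_top of_nat_less_top\<close>)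
  finally have "prefix_value ?M x (stopped_cost_sum ?M x) (markov_policy \<sigma>) < top" .
  moreover have "markov_policy \<sigma> \<in> policies ?M"
    using \<sigma> by (simp add: policies_def markov_policy_def base_mdp_def)
  ultimately show ?thesis by (intro exI[of _ \<sigma>]) (auto simp: \<sigma>_def)
qed

lemma marked_cost_policy_exists:
  assumes x: "x \<in> {0..NX}"
  shows "\<exists>\<sigma>. markov_policy \<sigma> \<in> policies (aug_mdp NC p f g) \<and>
    prefix_value (aug_mdp NC p f g) (x, Mark_s) (cost_sum (aug_mdp NC p f g) (x, Mark_s)) (markov_policy \<sigma>) < top \<and>
    (\<forall>t s. t < T \<longrightarrow> fst (\<sigma> t s) = greedy (T - Suc t) (fst s))"
proof -
  let ?M = "aug_mdp NC p f g"
  obtain L B where B: "B < (top :: ennreal)" and L_le: "\<And>y. L y \<le> B"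
    and L: "\<And>y u. y \<in> {0..NX} \<Longrightarrow> y \<notin> avoiding \<Longrightarrow> u \<in> {1..NC} \<Longrightarrow>
      (\<integral>\<^sup>+w. ennreal (g y u w) + L (f y u w) \<partial>p y u) \<le> L y"
    using lyapunov_exists by blast
  define \<sigma> :: "nat \<Rightarrow> nat \<times> mark \<Rightarrow> nat \<times> mark" where
    "\<sigma> t s = (if t < T then (greedy (T - Suc t) (fst s), Mark_s)
       else if fst s \<in> avoiding then (avoid (fst s), Mark_f) else (1, Mark_s))" for t s
  have \<sigma>: "fst (\<sigma> t s) \<in> {1..NC}" for t s
    using greedy(1) avoid(1) actions_nonempty by (simp add: \<sigma>_def)
  \<comment> \<open>\<open>Mark_f\<close> occurs only together with \<open>avoiding\<close>, so the
    state \<open>(0, Mark_f)\<close> with its unit cost per step is never visited.\<close>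
  define inv where "inv t s \<longleftrightarrow> fst s \<in> {0..NX} \<and> (snd s = Mark_f \<longrightarrow> T \<le> t \<and> fst s \<in> avoiding)" for t and s :: "nat \<times> mark"
  let ?G = "ennreal mean_bound"
  \<comment> \<open>The additional \<open>?G\<close> pays for the switching step: in a state marked
    \<open>Mark_s\<close> the stage cost is due even when the action sets the mark to
    \<open>Mark_f\<close>.\<close>
  define \<Psi> where "\<Psi> t s = (if t < T then of_nat (T - t) * ?G + (B + ?G)
    else if snd s = Mark_s then L (fst s) + ?G else 0)" for t and s :: "nat \<times> mark"
  have \<Psi>_le: "\<Psi> t s \<le> of_nat (T - t) * ?G + (B + ?G)" for t s
    using L_le[of "fst s"] by (auto simp: \<Psi>_def intro!: add_increasing add_right_mono)
  have tr: "trans ?M s a w = (f (fst s) (fst a) w, theta (snd s) (snd a))"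
    and dist: "disturbance ?M s a = p (fst s) (fst a)" for s a w
    by (auto simp: aug_mdp_def split: prod.splits)
  have inv_step: "inv (Suc t) (trans ?M s (\<sigma> t s) w)"
    if "inv t s" "w \<in> set_pmf (disturbance ?M s (\<sigma> t s))" for t s w
  proof -
    have "f (fst s) (fst (\<sigma> t s)) w \<in> {0..NX}" using that(1) closed \<sigma> by (simp add: inv_def)
    moreover have "T \<le> Suc t \<and> f (fst s) (fst (\<sigma> t s)) w \<in> avoiding"
      if "theta (snd s) (snd (\<sigma> t s)) = Mark_f"
    proof -
      have "\<not> t < T \<and> fst s \<in> avoiding"
        using that \<open>inv t s\<close> by (cases "snd s") (auto simp: inv_def \<sigma>_def theta_def split: if_splits)
      then show ?thesis using avoid(2) \<open>w \<in> _\<close> by (auto simp: \<sigma>_def dist)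
    qed
    ultimately show ?thesis by (simp add: inv_def tr)
  qed
  interpret invariant_process ?M "markov_policy \<sigma>" "(x, Mark_s)" "\<lambda>t s u. u = \<sigma> t s" inv
    using x inv_step by unfold_locales (auto simp: markov_policy_def inv_def)
  have "prefix_value ?M (x, Mark_s) (cost_sum ?M (x, Mark_s)) (markov_policy \<sigma>) \<le> \<Psi> 0 (x, Mark_s)"
  proof (rule prefix_value_le_potential[where \<kappa>="\<lambda>t s u w. ennreal (stage_cost ?M s u w)"])
    show "cost_sum ?M (x, Mark_s) n ((!) a) \<le>
        (\<Sum>t<n. ennreal (stage_cost ?M (state_at ?M (x, Mark_s) ((!) a) t) (fst (a ! t)) (snd (a ! t))))" for n a
      by (simp add: cost_sum_def cost_at_def)
  next
    fix t s u assume I: "inv t s" and u: "u = \<sigma> t s"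
    obtain y i where s: "s = (y, i)" by (cases s)
    have y: "y \<in> {0..NX}" using I by (simp add: inv_def s)
    have uA: "fst u \<in> {1..NC}" using \<sigma> u by simp
    have cost_s: "stage_cost ?M s u w = g y (fst u) w" if "i = Mark_s" for w
      using that by (cases u) (simp add: s aug_mdp_def)
    have "(\<integral>\<^sup>+w. ennreal (stage_cost ?M s u w) + \<Psi> (Suc t) (f y (fst u) w, theta i (snd u)) \<partial>p y (fst u)) \<le> \<Psi> t s"
    proof (cases "t < T")
      case True
      then have i: "i = Mark_s" using I by (cases i) (auto simp: inv_def s)
      have "(\<integral>\<^sup>+w. ennreal (stage_cost ?M s u w) + \<Psi> (Suc t) (f y (fst u) w, theta i (snd u)) \<partial>p y (fst u)) \<le>
          (\<integral>\<^sup>+w. ennreal (g y (fst u) w) + (of_nat (T - Suc t) * ?G + (B + ?G)) \<partial>p y (fst u))"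
        by (intro nn_integral_mono add_mono \<Psi>_le) (simp add: cost_s i)
      also have "\<dots> = (\<integral>\<^sup>+w. ennreal (g y (fst u) w) \<partial>p y (fst u)) + (of_nat (T - Suc t) * ?G + (B + ?G))"
        by (simp add: nn_integral_add)
      also have "\<dots> \<le> ?G + (of_nat (T - Suc t) * ?G + (B + ?G))"
        by (intro add_right_mono nn_integral_cost_le y uA)
      also have "\<dots> = of_nat (Suc (T - Suc t)) * ?G + (B + ?G)"
        by (simp add: distrib_right add.assoc)
      also have "Suc (T - Suc t) = T - t" using True by simp
      finally show ?thesis using True by (simp add: \<Psi>_def)
    next
      case False
      show ?thesis
      proof (cases i)
        case Mark_f
        then have "y \<noteq> 0" using I zero_not_avoiding by (cases "y = 0") (auto simp: inv_def s)
        then have "stage_cost ?M s u w = 0" for w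
          using Mark_f by (cases u) (simp add: s aug_mdp_def)
        then show ?thesis using False Mark_f by (simp add: \<Psi>_def theta_def)
      next
        case Mark_s
        show ?thesis
        proof (cases "y \<in> avoiding")
          case True
          then have "theta i (snd u) = Mark_f" using False by (simp add: u \<sigma>_def s theta_def)
          then have "(\<integral>\<^sup>+w. ennreal (stage_cost ?M s u w) + \<Psi> (Suc t) (f y (fst u) w, theta i (snd u)) \<partial>p y (fst u)) \<le> ?G"
            using nn_integral_cost_le[OF y uA] False by (simp add: \<Psi>_def cost_s Mark_s)
          then show ?thesis using False Mark_s by (simp add: \<Psi>_def s add_increasing)
        next
          case False': False
          then have "theta i (snd u) = Mark_s" using False Mark_s by (simp add: u \<sigma>_def s theta_def)
          then have "(\<integral>\<^sup>+w. ennreal (stage_cost ?M s u w) + \<Psi> (Suc t) (f y (fst u) w, theta i (snd u)) \<partial>p y (fst u)) =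
              (\<integral>\<^sup>+w. (ennreal (g y (fst u) w) + L (f y (fst u) w)) + ?G \<partial>p y (fst u))"
            using False by (simp add: \<Psi>_def cost_s Mark_s add.assoc)
          also have "\<dots> = (\<integral>\<^sup>+w. (ennreal (g y (fst u) w) + L (f y (fst u) w)) \<partial>p y (fst u)) + ?G"
            by (subst nn_integral_add) simp_all
          also have "\<dots> \<le> L y + ?G"
            by (intro add_right_mono L y False' uA)
          finally show ?thesis using False Mark_s by (simp add: \<Psi>_def s)
        qed
      qed
    qed
    then show "(\<integral>\<^sup>+w. ennreal (stage_cost ?M s u w) + \<Psi> (Suc t) (trans ?M s u w) \<partial>disturbance ?M s u) \<le> \<Psi> t s"
      by (simp add: tr dist s)
  qed
  also have "\<dots> < top"
    by (rule order.strict_trans1[OF \<Psi>_le]) (use B in \<open>simp add: ennreal_mult_less_top of_nat_less_top\<close>)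
  finally have "prefix_value ?M (x, Mark_s) (cost_sum ?M (x, Mark_s)) (markov_policy \<sigma>) < top" .
  moreover have "snd (\<sigma> t s) \<in> {Mark_s, Mark_f}" for t s by (simp add: \<sigma>_def)
  then have "markov_policy \<sigma> \<in> policies ?M"
    using \<sigma> by (simp add: policies_def markov_policy_def aug_mdp_def mem_Times_iff)
  ultimately show ?thesis by (intro exI[of _ \<sigma>]) (auto simp: \<sigma>_def)
qed

end

text \<open>With \<open>c_star \<eta> P J \<le> ereal c\<close> this gives \<open>0 \<le> c\<close>,
  so the condition enters with a nonnegative coefficient \<eta>/\<epsilon>.\<close>

lemma c_star_nonneg: "0 \<le> c_star \<eta> P J"
  unfolding c_star_def by (intro Inf_greatest) auto

theorem theorem7:
  fixes NX NC :: nat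
    and p :: "nat \<Rightarrow> nat \<Rightarrow> ('w::countable) pmf"
    and f :: "nat \<Rightarrow> nat \<Rightarrow> 'w \<Rightarrow> nat"
    and g :: "nat \<Rightarrow> nat \<Rightarrow> 'w \<Rightarrow> real"
    and \<gamma> \<epsilon> :: real and x :: nat
  assumes actions_nonempty: "1 \<le> NC"
    and closed: "\<And>y u w. y \<in> {0..NX} \<Longrightarrow> u \<in> {1..NC} \<Longrightarrow> f y u w \<in> {0..NX}"
    and cost_nonneg: "\<And>y u w. y \<in> {0..NX} \<Longrightarrow> u \<in> {1..NC} \<Longrightarrow> 0 \<le> g y u w"
    and finite_mean: "\<And>y u. y \<in> {0..NX} \<Longrightarrow> u \<in> {1..NC} \<Longrightarrow> integrable (measure_pmf (p y u)) (g y u)"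
    and finite_variance: "\<And>y u. y \<in> {0..NX} \<Longrightarrow> u \<in> {1..NC} \<Longrightarrow>
      integrable (measure_pmf (p y u)) (\<lambda>w. (g y u w - measure_pmf.expectation (p y u) (g y u))\<^sup>2)"
    and terminal: "\<And>u w. u \<in> {1..NC} \<Longrightarrow> f 0 u w = 0 \<and> g 0 u w = 0"
    and gamma: "0 < \<gamma>" "\<gamma> < 1"
    and eps: "0 < \<epsilon>"
    and x: "x \<in> {0..NX}"
  shows "(\<epsilon> < 1 \<longrightarrow>
           (\<forall>c::real.
              c_star (eta_S \<epsilon>) (policies (base_mdp NC p f g)) (J_S (base_mdp NC p f g) \<gamma> \<epsilon> x) \<le> ereal c \<longrightarrow>
              minimax_equality (policies (base_mdp NC p f g)) weights (J_S (base_mdp NC p f g) \<gamma> \<epsilon> x c)))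
       \<and> (\<forall>c::real.
            c_star (eta_M \<epsilon>) (policies (aug_mdp NC p f g)) (J_M (aug_mdp NC p f g) \<gamma> \<epsilon> (x, Mark_s)) \<le> ereal c \<longrightarrow>
            minimax_equality (policies (aug_mdp NC p f g)) weights (J_M (aug_mdp NC p f g) \<gamma> \<epsilon> (x, Mark_s) c))"
proof -
  interpret terminal_mdp NX NC p f g \<gamma>
    using actions_nonempty closed cost_nonneg finite_mean terminal gamma by unfold_locales
  have c_nonneg: "0 \<le> c" if "c_star \<eta> P J \<le> ereal c" for c \<eta> and P :: "'p set" and J
    using order_trans[OF c_star_nonneg that] by simp
  show ?thesis
  proof (intro conjI impI allI)
    fix c assume eps1: "\<epsilon> < 1"
      and c: "c_star (eta_S \<epsilon>) (policies (base_mdp NC p f g)) (J_S (base_mdp NC p f g) \<gamma> \<epsilon> x) \<le> ereal c"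
    have "0 \<le> eta_S \<epsilon> c / \<epsilon>" using c_nonneg[OF c] eps eps1 by (simp add: eta_S_def)
    with stopped_cost_policy_exists[OF x]
    have "minimax_equality (policies (base_mdp NC p f g)) weights
      (\<lambda>\<alpha> \<pi>. ennreal (fst \<alpha>) * prefix_value (base_mdp NC p f g) x (stopped_cost_sum (base_mdp NC p f g) x) \<pi> +
         ennreal (eta_S \<epsilon> c / \<epsilon> * snd \<alpha>) * prefix_value (base_mdp NC p f g) x (disc_sum (base_mdp NC p f g) id \<gamma> x) \<pi>)"
      by (intro minimax_equality_scalarize[where \<nu>=id])
         (use actions_nonempty in \<open>auto simp: base_mdp_def stopped_cost_sum_less_top\<close>)
    then show "minimax_equality (policies (base_mdp NC p f g)) weights (J_S (base_mdp NC p f g) \<gamma> \<epsilon> x c)"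
      by (simp add: J_S_def[abs_def] scalarize_def J_obj_S_eq J_cond_eq)
  next
    fix c assume c: "c_star (eta_M \<epsilon>) (policies (aug_mdp NC p f g)) (J_M (aug_mdp NC p f g) \<gamma> \<epsilon> (x, Mark_s)) \<le> ereal c"
    have "0 \<le> eta_M \<epsilon> c / \<epsilon>" using c_nonneg[OF c] eps by (simp add: eta_M_def)
    with marked_cost_policy_exists[OF x]
    have "minimax_equality (policies (aug_mdp NC p f g)) weights
      (\<lambda>\<alpha> \<pi>. ennreal (fst \<alpha>) * prefix_value (aug_mdp NC p f g) (x, Mark_s) (cost_sum (aug_mdp NC p f g) (x, Mark_s)) \<pi> +
         ennreal (eta_M \<epsilon> c / \<epsilon> * snd \<alpha>) *
           prefix_value (aug_mdp NC p f g) (x, Mark_s) (disc_sum (aug_mdp NC p f g) fst \<gamma> (x, Mark_s)) \<pi>)"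
      by (intro minimax_equality_scalarize[where \<nu>=fst])
         (use actions_nonempty in \<open>auto simp: aug_mdp_def cost_sum_less_top split: prod.splits\<close>)
    then show "minimax_equality (policies (aug_mdp NC p f g)) weights (J_M (aug_mdp NC p f g) \<gamma> \<epsilon> (x, Mark_s) c)"
      by (simp add: J_M_def[abs_def] scalarize_def J_obj_M_eq J_cond_eq)
  qed
qed

end
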